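(* The algebra $\bar{\mathcal{A}}_{0}$ is isomorphic to the (unital associative) algebra over $\mathbb{C}$ generated by $\bar{Y}_0$ and $\bar{Y}^{*}_{0}$, subject to the relation $\bar{Y}_{0}\bar{Y}^{*}_{0}=\bar{Y}^{*}_{0}\bar{Y}_{0}=1$. Equivalently, $\bar{\mathcal{A}}_{0}$ is isomorphic to the group algebra $\mathbb{C}[\mathbb{Z}]$ of $\mathbb{Z}$.
   Context: $\mathcal{A}$ denotes the associative algebra with identity over $\mathbb{C}$ with generators $Y_n, Y_n^{*}$ ($n\in\mathbb{Z}$), subject to the relations $$Y_mY_n+Y_{n+1}Y_{m-1}=0,\qquad Y_m^{*}Y_n^{*}+Y_{n+1}^{*}Y_{m-1}^{*}=0,\qquad Y_mY_n^{*}+Y_{n-1}^{*}Y_{m+1}=\delta_{m+n,0}$$ for $m,n\in\mathbb{Z}$. It is $\mathbb{Z}$-graded by $\deg Y_n=-n=\deg Y_n^{*}$; $\mathcal{A}_n$ denotes the homogeneous subspace of degree $n$. The subspace $I_0=\sum_{n\ge1}\mathcal{A}_n\mathcal{A}_{-n}$ is a two-sided ideal of the subalgebra $\mathcal{A}_0$, and $\bar{\mathcal{A}}_0=\mathcal{A}_0/I_0$. *)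

theory Defs
  imports Complex_Main "HOL-Library.Poly_Mapping" "HOL-Algebra.QuotRing" "HOL-Algebra.Module"
begin

text \<open>
  A unital associative algebra over the complex numbers is represented by the HOL-Algebra record
  type \<^type>\<open>module\<close> with scalar type \<^typ>\<open>complex\<close>, used with its multiplication and unit.
  (The locale \<open>algebra\<close> of the library covers commutative algebras only.)
\<close>

type_synonym 'a calgebra = "(complex, 'a) module"

definition calg_iso :: "'a calgebra \<Rightarrow> 'b calgebra \<Rightarrow> ('a \<Rightarrow> 'b) set" where
  "calg_iso A B = {h \<in> ring_iso A B.
     \<forall>c. \<forall>x \<in> carrier A. h (c \<odot>\<^bsub>A\<^esub> x) = c \<odot>\<^bsub>B\<^esub> h x}"

definition calg_quot :: "'a calgebra \<Rightarrow> 'a set \<Rightarrow> 'a set calgebra" where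
  "calg_quot A I =
     \<lparr>carrier = carrier (A Quot I), mult = mult (A Quot I), one = one (A Quot I),
      zero = zero (A Quot I), add = add (A Quot I),
      smult = (\<lambda>c X. \<Union>x\<in>X. I +>\<^bsub>A\<^esub> (c \<odot>\<^bsub>A\<^esub> x))\<rparr>"

inductive_set lin_span :: "'a calgebra \<Rightarrow> 'a set \<Rightarrow> 'a set"
  for A :: "'a calgebra" and S :: "'a set" where
  zero: "\<zero>\<^bsub>A\<^esub> \<in> lin_span A S"
| incl: "x \<in> S \<Longrightarrow> x \<in> lin_span A S"
| add: "x \<in> lin_span A S \<Longrightarrow> y \<in> lin_span A S \<Longrightarrow> x \<oplus>\<^bsub>A\<^esub> y \<in> lin_span A S"
| smult: "x \<in> lin_span A S \<Longrightarrow> c \<odot>\<^bsub>A\<^esub> x \<in> lin_span A S"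


text \<open>
  The monoid algebra of an additively written monoid: the product of
  \<^typ>\<open>'m \<Rightarrow>\<^sub>0 complex\<close> is convolution. At \<^typ>\<open>int\<close> it is the group algebra of the integers.
\<close>

definition monoid_calg :: "('m::monoid_add \<Rightarrow>\<^sub>0 complex) calgebra" where
  "monoid_calg = \<lparr>carrier = UNIV, mult = (*), one = 1, zero = 0, add = (+),
     smult = (\<lambda>c f. Poly_Mapping.map ((*) c) f)\<rparr>"

abbreviation group_calg_int :: "(int \<Rightarrow>\<^sub>0 complex) calgebra" where
  "group_calg_int \<equiv> monoid_calg"

text \<open>
  The free monoid, written additively only because \<^theory>\<open>HOL-Library.Poly_Mapping\<close> expects
  an additive exponent monoid; its monoid algebra is the free associative algebra.
\<close>

datatype 'g fmon = FMon (letters: "'g list")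

instantiation fmon :: (type) monoid_add
begin

definition zero_fmon :: "'g fmon" where
  "zero_fmon = FMon []"

definition plus_fmon :: "'g fmon \<Rightarrow> 'g fmon \<Rightarrow> 'g fmon" where
  "plus_fmon u v = FMon (letters u @ letters v)"

instance
  by standard (auto simp: zero_fmon_def plus_fmon_def)

end

type_synonym 'g free = "'g fmon \<Rightarrow>\<^sub>0 complex"

abbreviation free_calg :: "'g free calgebra" where
  "free_calg \<equiv> monoid_calg"

definition gen :: "'g \<Rightarrow> 'g free" where
  "gen g = Poly_Mapping.single (FMon [g]) 1"

text \<open>The algebra generated by the type \<^typ>\<open>'g\<close> subject to \<open>r = 0\<close> for all \<open>r \<in> R\<close>.\<close>

definition presented_calg :: "'g free set \<Rightarrow> 'g free set calgebra" where
  "presented_calg R = calg_quot free_calg (Idl\<^bsub>free_calg\<^esub> R)"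

definition presented_class :: "'g free set \<Rightarrow> 'g free \<Rightarrow> 'g free set" where
  "presented_class R f = Idl\<^bsub>free_calg\<^esub> R +>\<^bsub>free_calg\<^esub> f"


datatype Agen = Y int | Ystar int

definition A_rels :: "Agen free set" where
  "A_rels =
     {gen (Y m) * gen (Y n) + gen (Y (n + 1)) * gen (Y (m - 1)) | m n. True} \<union>
     {gen (Ystar m) * gen (Ystar n) + gen (Ystar (n + 1)) * gen (Ystar (m - 1)) | m n. True} \<union>
     {gen (Y m) * gen (Ystar n) + gen (Ystar (n - 1)) * gen (Y (m + 1))
        - (if m + n = 0 then 1 else 0) | m n. True}"

definition A_alg :: "Agen free set calgebra" where
  "A_alg = presented_calg A_rels"

fun gen_deg :: "Agen \<Rightarrow> int" where
  "gen_deg (Y n) = - n"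
| "gen_deg (Ystar n) = - n"

definition word_deg :: "Agen fmon \<Rightarrow> int" where
  "word_deg w = sum_list (map gen_deg (letters w))"

text \<open>The relators are homogeneous, so the grading of the free algebra induces one on the quotient.\<close>

definition A_hom :: "int \<Rightarrow> Agen free set set" where
  "A_hom n = presented_class A_rels ` {f. \<forall>w \<in> Poly_Mapping.keys f. word_deg w = n}"

definition A0_alg :: "Agen free set calgebra" where
  "A0_alg = A_alg\<lparr>carrier := A_hom 0\<rparr>"

definition I0 :: "Agen free set set" where
  "I0 = lin_span A_alg
     (\<Union>n\<in>{1..}. {a \<otimes>\<^bsub>A_alg\<^esub> b | a b. a \<in> A_hom n \<and> b \<in> A_hom (- n)})"

definition A0bar :: "Agen free set set calgebra" where
  "A0bar = calg_quot A0_alg I0"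

definition A0bar_class :: "Agen free \<Rightarrow> Agen free set set" where
  "A0bar_class f = I0 +>\<^bsub>A0_alg\<^esub> presented_class A_rels f"


datatype Bgen = Y0bar | Y0starbar

definition B_rels :: "Bgen free set" where
  "B_rels = {gen Y0bar * gen Y0starbar - 1, gen Y0starbar * gen Y0bar - 1}"

definition B_alg :: "Bgen free set calgebra" where
  "B_alg = presented_calg B_rels"

end

theory Submission
  imports Defs "HOL-Algebra.Subrings" "HOL-Library.Nat_Bijection"
begin

text \<open>
  The relations with indices \<open>(0, 0)\<close> and \<open>(-1, 1)\<close> make the classes of \<open>Y 0\<close> and \<open>Ystar 0\<close>
  mutually inverse modulo \<open>I0\<close>. Modulo the left ideal generated by the elements of negative degree,
  every word reduces to words in which letters of positive degree precede letters of degree 0, so a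
  word of degree 0 reduces to one in \<open>Y 0\<close> and \<open>Ystar 0\<close>; hence their powers span the quotient.
  For linear independence, \<open>A\<close> acts on the fermionic Fock space: on a semi-infinite wedge \<open>S\<close> of
  charge \<open>c\<close>, \<open>Y n\<close> inserts \<open>c - n\<close> and \<open>Ystar n\<close> removes \<open>c - 1 + n\<close>. The degree is the change
  of energy and the energy is nonnegative, so negative degrees kill the vacuum, \<open>I0\<close> acts on it by
  zero, and the powers of \<open>Y 0\<close> send it to the distinct vacua of all charges.
\<close>

subsection \<open>Algebras over the complex numbers\<close>

text \<open>\<open>A0_alg\<close> is cut out of \<open>A_alg\<close> as a subspace, without a
  presentation of its own, so no universal property yields a map out of it. \<open>A0bar\<close> and
  the Laurent polynomials are instead both taken as images of the degree 0 part of the free algebra,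
  and the isomorphism amounts to equality of the fibres of the two maps. Multiplicativity of the
  vacuum coefficient in degree 0 is not visible from its definition, which tests only the vacuum of
  charge 0; it follows from the spanning statement and from multiplicativity on powers. The obstacle
  in the reduction is that the relations also shift degrees: pulling a positive letter to the front
  may leave it with degree 0. For two letters of the same kind with degrees 0 and 1 the relation
  reproduces the product itself, so twice the product vanishes; in the other case a second pass is
  needed, in which the trouble cannot recur.\<close>

locale calg = ring A for A :: "'a calgebra" (structure) +
  assumes smult_closed [intro, simp]: "x \<in> carrier A \<Longrightarrow> c \<odot> x \<in> carrier A"
    and smult_add: "x \<in> carrier A \<Longrightarrow> y \<in> carrier A \<Longrightarrow> c \<odot> (x \<oplus> y) = c \<odot> x \<oplus> c \<odot> y"
    and smult_mult_left: "x \<in> carrier A \<Longrightarrow> y \<in> carrier A \<Longrightarrow> (c \<odot> x) \<otimes> y = c \<odot> (x \<otimes> y)"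
    and smult_mult_right: "x \<in> carrier A \<Longrightarrow> y \<in> carrier A \<Longrightarrow> x \<otimes> (c \<odot> y) = c \<odot> (x \<otimes> y)"
    and smult_minus_one: "x \<in> carrier A \<Longrightarrow> (-1) \<odot> x = \<ominus> x"
begin

text \<open>A scalar acts as multiplication by a multiple of the unit, so a ring ideal is
  automatically a subspace.\<close>

lemma ideal_smult_closed:
  assumes "ideal I A" "x \<in> I"
  shows "c \<odot> x \<in> I"
proof -
  interpret ideal I A by fact
  have x: "x \<in> carrier A" using assms(2) by (rule Icarr)
  have "c \<odot> x = (c \<odot> \<one>) \<otimes> x" using x by (simp add: smult_mult_left)
  also have "\<dots> \<in> I" using assms(2) by (intro I_l_closed) auto
  finally show ?thesis .
qed

lemma quot_simps:
  assumes "ideal I A"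
  shows "carrier (calg_quot A I) = (+>) I ` carrier A"
    and "x \<in> carrier A \<Longrightarrow> y \<in> carrier A \<Longrightarrow>
           (I +> x) \<oplus>\<^bsub>calg_quot A I\<^esub> (I +> y) = I +> (x \<oplus> y)"
    and "x \<in> carrier A \<Longrightarrow> y \<in> carrier A \<Longrightarrow>
           (I +> x) \<otimes>\<^bsub>calg_quot A I\<^esub> (I +> y) = I +> (x \<otimes> y)"
    and "\<one>\<^bsub>calg_quot A I\<^esub> = I +> \<one>"
    and "\<zero>\<^bsub>calg_quot A I\<^esub> = I +> \<zero>"
    and "x \<in> carrier A \<Longrightarrow> c \<odot>\<^bsub>calg_quot A I\<^esub> (I +> x) = I +> (c \<odot> x)"
proof -
  interpret ideal I A by fact
  show "carrier (calg_quot A I) = (+>) I ` carrier A"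
    by (auto simp: calg_quot_def FactRing_def A_RCOSETS_def')
  show "\<one>\<^bsub>calg_quot A I\<^esub> = I +> \<one>"
    by (simp add: calg_quot_def FactRing_def)
  show "\<zero>\<^bsub>calg_quot A I\<^esub> = I +> \<zero>"
    using a_rcos_zero[OF assms, of \<zero>] by (simp add: calg_quot_def FactRing_def)
  show "(I +> x) \<oplus>\<^bsub>calg_quot A I\<^esub> (I +> y) = I +> (x \<oplus> y)"
    if "x \<in> carrier A" "y \<in> carrier A"
    using that by (simp add: calg_quot_def FactRing_def a_rcos_sum)
  show "(I +> x) \<otimes>\<^bsub>calg_quot A I\<^esub> (I +> y) = I +> (x \<otimes> y)"
    if "x \<in> carrier A" "y \<in> carrier A"
    using that by (simp add: calg_quot_def FactRing_def rcoset_mult_add)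
  show "c \<odot>\<^bsub>calg_quot A I\<^esub> (I +> x) = I +> (c \<odot> x)" if x: "x \<in> carrier A"
  proof -
    \<comment> \<open>Every member of the coset contributes the same coset to the union that defines
      the scalar action, so the union collapses.\<close>
    have "I +> (c \<odot> y) = I +> (c \<odot> x)" if y: "y \<in> I +> x" for y
    proof -
      obtain i where i: "i \<in> I" "y = i \<oplus> x"
        using y by (auto simp: a_r_coset_def')
      have "c \<odot> y = c \<odot> i \<oplus> c \<odot> x"
        using i x by (simp add: smult_add Icarr)
      hence "c \<odot> y \<in> I +> (c \<odot> x)"
        using ideal_smult_closed[OF assms i(1)] by (auto simp: a_r_coset_def')
      thus ?thesis
        using x by (metis a_repr_independence' smult_closed)
    qed
    moreover have "x \<in> I +> x" using x by (rule a_rcos_self)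
    ultimately have "(\<Union>y\<in>I +> x. I +> (c \<odot> y)) = I +> (c \<odot> x)"
      by blast
    thus ?thesis by (simp add: calg_quot_def)
  qed
qed

lemma quot_ring:
  assumes "ideal I A"
  shows "ring (calg_quot A I)"
proof -
  interpret Q: ring "A Quot I" using assms by (rule ideal.quotient_is_ring)
  have eqs: "carrier (calg_quot A I) = carrier (A Quot I)" "mult (calg_quot A I) = mult (A Quot I)"
      "one (calg_quot A I) = one (A Quot I)" "zero (calg_quot A I) = zero (A Quot I)"
      "add (calg_quot A I) = add (A Quot I)"
    by (simp_all add: calg_quot_def)
  show ?thesis
  proof (intro ringI abelian_groupI monoidI, unfold eqs)
    show "x \<oplus>\<^bsub>A Quot I\<^esub> y = y \<oplus>\<^bsub>A Quot I\<^esub> x"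
      if "x \<in> carrier (A Quot I)" "y \<in> carrier (A Quot I)" for x y
      using that by (rule Q.a_comm)
    show "\<exists>y\<in>carrier (A Quot I). y \<oplus>\<^bsub>A Quot I\<^esub> x = \<zero>\<^bsub>A Quot I\<^esub>"
      if "x \<in> carrier (A Quot I)" for x
      using that Q.l_neg by blast
  qed (simp_all add: Q.a_assoc Q.m_assoc Q.l_distr Q.r_distr)
qed

lemma quot_calg:
  assumes "ideal I A"
  shows "calg (calg_quot A I)"
proof -
  interpret Q: ring "calg_quot A I" by (rule quot_ring[OF assms])
  note S = quot_simps[OF assms]
  have "(-1) \<odot>\<^bsub>calg_quot A I\<^esub> (I +> x) = \<ominus>\<^bsub>calg_quot A I\<^esub> (I +> x)"
    if x: "x \<in> carrier A" for x
    using x Q.minus_equality[of "I +> (\<ominus> x)" "I +> x"] by (simp add: S smult_minus_one l_neg)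
  thus ?thesis
    by unfold_locales
      (auto simp: S smult_add smult_mult_left smult_mult_right)
qed

lemma coset_eq_iff:
  assumes "ideal I A" "x \<in> carrier A" "y \<in> carrier A"
  shows "I +> x = I +> y \<longleftrightarrow> x \<ominus> y \<in> I"
  using quotient_eq_iff_same_a_r_cos[OF assms(1-3)] by auto

text \<open>Negation is the scalar -1, so closure under scalars supplies additive inverses.\<close>

lemma subalg_calg:
  assumes "H \<subseteq> carrier A" "\<one> \<in> H"
    and "\<And>x y. x \<in> H \<Longrightarrow> y \<in> H \<Longrightarrow> x \<otimes> y \<in> H"
    and "\<And>x y. x \<in> H \<Longrightarrow> y \<in> H \<Longrightarrow> x \<oplus> y \<in> H"
    and smult: "\<And>c x. x \<in> H \<Longrightarrow> c \<odot> x \<in> H"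
  shows "calg (A\<lparr>carrier := H\<rparr>)"
proof -
  have "\<ominus> x \<in> H" if "x \<in> H" for x
    using smult[OF that, of "-1"] that assms(1) smult_minus_one by auto
  hence H: "subring H A"
    using assms by (intro subringI) auto
  then interpret H: ring "A\<lparr>carrier := H\<rparr>" by (rule subring_is_ring)
  have "(-1) \<odot> x = \<ominus>\<^bsub>A\<lparr>carrier := H\<rparr>\<^esub> x" if x: "x \<in> H" for x
  proof -
    have "x \<in> carrier A" "\<ominus> x \<in> H"
      using x assms(1) \<open>\<And>x. x \<in> H \<Longrightarrow> \<ominus> x \<in> H\<close> by auto
    thus ?thesis
      using x H.minus_equality[of "\<ominus> x" x] by (simp add: smult_minus_one l_neg)
  qed
  thus ?thesis
    using assms(1) smult
    by unfold_locales (auto simp: smult_add smult_mult_left smult_mult_right subset_iff)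
qed

end

section \<open>Isomorphisms of algebras\<close>

lemma calg_iso_sym:
  assumes "calg A" "h \<in> calg_iso A B"
  shows "inv_into (carrier A) h \<in> calg_iso B A"
proof -
  interpret calg A by fact
  let ?g = "inv_into (carrier A) h"
  have h: "h \<in> ring_iso A B" "\<And>c x. x \<in> carrier A \<Longrightarrow> h (c \<odot>\<^bsub>A\<^esub> x) = c \<odot>\<^bsub>B\<^esub> h x"
    using assms by (auto simp: calg_iso_def)
  have bij: "bij_betw h (carrier A) (carrier B)"
    using h(1) by (simp add: ring_iso_def)
  have "?g (c \<odot>\<^bsub>B\<^esub> y) = c \<odot>\<^bsub>A\<^esub> ?g y" if "y \<in> carrier B" for c y
  proof -
    have "?g y \<in> carrier A" "h (?g y) = y"
      using that bij by (auto simp: bij_betw_def inv_into_into f_inv_into_f)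
    thus ?thesis
      using bij h(2) by (metis bij_betw_inv_into_left smult_closed)
  qed
  thus ?thesis
    using ring_iso_set_sym[OF ring_axioms h(1)] by (auto simp: calg_iso_def)
qed

lemma calg_iso_trans:
  assumes "g \<in> calg_iso A B" "h \<in> calg_iso B C"
  shows "h \<circ> g \<in> calg_iso A C"
proof -
  have g: "g \<in> ring_iso A B" and h: "h \<in> ring_iso B C"
    using assms by (auto simp: calg_iso_def)
  have "g x \<in> carrier B" if "x \<in> carrier A" for x
    using g that by (auto simp: ring_iso_def ring_hom_def)
  thus ?thesis
    using assms ring_iso_set_trans[OF g h] by (simp add: calg_iso_def)
qed

text \<open>Two maps on \<open>D\<close> with the same fibres induce a bijection of their images.
  Each operation is only required to have a common lift in \<open>D\<close>; this is applied to the
  degree 0 part of the free algebra for \<open>A0bar\<close> and to a whole free algebra for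
  \<open>B_alg\<close>.\<close>

lemma calg_iso_common_cover:
  assumes carrier: "p ` D = carrier A" "q ` D = carrier B"
    and fibres: "\<And>f g. f \<in> D \<Longrightarrow> g \<in> D \<Longrightarrow> p f = p g \<longleftrightarrow> q f = q g"
    and one: "e \<in> D" "p e = \<one>\<^bsub>A\<^esub>" "q e = \<one>\<^bsub>B\<^esub>"
    and add: "\<And>f g. f \<in> D \<Longrightarrow> g \<in> D \<Longrightarrow> \<exists>h\<in>D. p h = p f \<oplus>\<^bsub>A\<^esub> p g \<and> q h = q f \<oplus>\<^bsub>B\<^esub> q g"
    and mult: "\<And>f g. f \<in> D \<Longrightarrow> g \<in> D \<Longrightarrow> \<exists>h\<in>D. p h = p f \<otimes>\<^bsub>A\<^esub> p g \<and> q h = q f \<otimes>\<^bsub>B\<^esub> q g"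
    and smult: "\<And>c f. f \<in> D \<Longrightarrow> \<exists>h\<in>D. p h = c \<odot>\<^bsub>A\<^esub> p f \<and> q h = c \<odot>\<^bsub>B\<^esub> q f"
  obtains \<phi> where "\<phi> \<in> calg_iso A B" "\<And>f. f \<in> D \<Longrightarrow> \<phi> (p f) = q f"
proof
  \<comment> \<open>Any preimage serves, since \<open>q\<close> is constant on the fibres of
    \<open>p\<close>.\<close>
  define \<phi> where "\<phi> = (\<lambda>x. q (inv_into D p x))"
  show *: "\<phi> (p f) = q f" if "f \<in> D" for f
    using that fibres[of "inv_into D p (p f)" f]
    by (auto simp: \<phi>_def inv_into_into f_inv_into_f)
  have "\<phi> \<in> ring_hom A B"
  proof (rule ring_hom_memI)
    show "\<phi> x \<in> carrier B" if "x \<in> carrier A" for x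
      using that * carrier by force
    show "\<phi> (x \<otimes>\<^bsub>A\<^esub> y) = \<phi> x \<otimes>\<^bsub>B\<^esub> \<phi> y" if "x \<in> carrier A" "y \<in> carrier A" for x y
      using that mult * unfolding carrier(1)[symmetric] by (metis imageE)
    show "\<phi> (x \<oplus>\<^bsub>A\<^esub> y) = \<phi> x \<oplus>\<^bsub>B\<^esub> \<phi> y" if "x \<in> carrier A" "y \<in> carrier A" for x y
      using that add * unfolding carrier(1)[symmetric] by (metis imageE)
    show "\<phi> \<one>\<^bsub>A\<^esub> = \<one>\<^bsub>B\<^esub>"
      using * one by metis
  qed
  moreover have "inj_on \<phi> (carrier A)"
    unfolding carrier(1)[symmetric] by (intro inj_onI) (auto simp: * fibres)
  moreover have "\<phi> ` carrier A = carrier B"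
    unfolding carrier(1)[symmetric] carrier(2)[symmetric] image_image by (simp add: *)
  moreover have "\<phi> (c \<odot>\<^bsub>A\<^esub> x) = c \<odot>\<^bsub>B\<^esub> \<phi> x" if "x \<in> carrier A" for c x
    using that smult * unfolding carrier(1)[symmetric] by (metis imageE)
  ultimately show "\<phi> \<in> calg_iso A B"
    by (simp add: calg_iso_def ring_iso_def bij_betw_def)
qed

section \<open>Monoid algebras\<close>

lemma monoid_calg_simps [simp]:
  "carrier monoid_calg = UNIV" "mult monoid_calg = (*)" "one monoid_calg = 1"
  "zero monoid_calg = 0" "add monoid_calg = (+)"
  "smult monoid_calg c f = Poly_Mapping.single 0 c * f"
  by (simp_all add: monoid_calg_def mult_map_scale_conv_mult)

lemma poly_mapping_linear_induct [case_names zero single add]: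
  fixes f :: "'m \<Rightarrow>\<^sub>0 'b::comm_monoid_add"
  assumes "P 0" "\<And>k c. P (Poly_Mapping.single k c)" "\<And>f g. P f \<Longrightarrow> P g \<Longrightarrow> P (f + g)"
  shows "P f"
proof (induction f rule: Poly_Mapping.update_induct)
  case const
  show ?case using assms(1) by simp
next
  case (update f k v)
  have "Poly_Mapping.update k v f = f + Poly_Mapping.single k v"
    using update(1)
    by (intro poly_mapping_eqI)
      (auto simp: lookup_update lookup_add lookup_single in_keys_iff)
  thus ?case using assms(2,3) update(3) by simp
qed

text \<open>Constants sit at the neutral exponent, hence are central even over a noncommutative
  monoid. Scalars are written as such constants throughout, which turns linear arguments into ring
  computations.\<close>

lemma single_zero_commute:
  fixes f :: "'m::monoid_add \<Rightarrow>\<^sub>0 'b::comm_semiring_0"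
  shows "f * Poly_Mapping.single 0 c = Poly_Mapping.single 0 c * f"
  by (induction f rule: poly_mapping_linear_induct)
    (auto simp: mult_single algebra_simps)

lemma monoid_calg_ring: "ring (monoid_calg :: ('m::monoid_add \<Rightarrow>\<^sub>0 complex) calgebra)"
proof (intro ringI abelian_groupI monoidI)
  fix x :: "'m \<Rightarrow>\<^sub>0 complex"
  show "\<exists>y\<in>carrier monoid_calg. y \<oplus>\<^bsub>monoid_calg\<^esub> x = \<zero>\<^bsub>monoid_calg\<^esub>"
    by (intro bexI[of _ "-x"]) auto
qed (auto simp: algebra_simps)

lemma monoid_calg_uminus [simp]:
  "\<ominus>\<^bsub>monoid_calg\<^esub> (x :: 'm::monoid_add \<Rightarrow>\<^sub>0 complex) = - x"
proof -
  interpret ring "monoid_calg :: ('m \<Rightarrow>\<^sub>0 complex) calgebra" by (rule monoid_calg_ring)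
  show ?thesis using minus_equality[of "-x" x] by simp
qed

lemma monoid_calg_minus [simp]:
  "(x :: 'm::monoid_add \<Rightarrow>\<^sub>0 complex) \<ominus>\<^bsub>monoid_calg\<^esub> y = x - y"
  by (simp add: a_minus_def)

lemma monoid_calg_calg: "calg (monoid_calg :: ('m::monoid_add \<Rightarrow>\<^sub>0 complex) calgebra)"
proof -
  interpret ring "monoid_calg :: ('m \<Rightarrow>\<^sub>0 complex) calgebra" by (rule monoid_calg_ring)
  have "x * (Poly_Mapping.single 0 c * y) = Poly_Mapping.single 0 c * (x * y)"
    for x y :: "'m \<Rightarrow>\<^sub>0 complex" and c
    by (metis mult.assoc single_zero_commute)
  thus ?thesis
    by unfold_locales (auto simp: algebra_simps single_uminus)
qed

subsection \<open>The Fock space action\<close>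

definition word :: "'g list \<Rightarrow> 'g free" where
  "word xs = Poly_Mapping.single (FMon xs) 1"

lemma word_Nil: "word [] = 1"
  by (simp add: word_def flip: zero_fmon_def)

lemma word_append: "word (xs @ ys) = word xs * word ys"
  by (simp add: word_def mult_single plus_fmon_def)

lemma gen_eq_word: "gen g = word [g]"
  by (simp add: gen_def word_def)

lemma word_Cons: "word (x # xs) = gen x * word xs"
  using word_append[of "[x]" xs] by (simp add: gen_eq_word)

lemma single_eq_smult_word: "Poly_Mapping.single w c = Poly_Mapping.single 0 c * word (letters w)"
  by (simp add: word_def mult_single)

definition lin_ext :: "('m \<Rightarrow> 'n \<Rightarrow>\<^sub>0 complex) \<Rightarrow> ('m \<Rightarrow>\<^sub>0 complex) \<Rightarrow> 'n::monoid_add \<Rightarrow>\<^sub>0 complex" where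
  "lin_ext h f = (\<Sum>w\<in>Poly_Mapping.keys f. Poly_Mapping.single 0 (Poly_Mapping.lookup f w) * h w)"

lemma lin_ext_superset:
  assumes "finite S" "Poly_Mapping.keys f \<subseteq> S"
  shows "lin_ext h f = (\<Sum>w\<in>S. Poly_Mapping.single 0 (Poly_Mapping.lookup f w) * h w)"
  unfolding lin_ext_def using assms
  by (intro sum.mono_neutral_left) (auto simp: in_keys_iff)

lemma lin_ext_zero [simp]: "lin_ext h 0 = 0"
  by (simp add: lin_ext_def)

lemma lin_ext_single [simp]: "lin_ext h (Poly_Mapping.single w c) = Poly_Mapping.single 0 c * h w"
  by (simp add: lin_ext_def)

lemma lin_ext_add: "lin_ext h (f + g) = lin_ext h f + lin_ext h g"
proof -
  let ?S = "Poly_Mapping.keys f \<union> Poly_Mapping.keys g"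
  have "Poly_Mapping.keys (f + g) \<subseteq> ?S" by (rule keys_add)
  thus ?thesis
    by (simp add: lin_ext_superset[of ?S] lookup_add single_add distrib_right sum.distrib)
qed

lemma lin_ext_smult:
  "lin_ext h (Poly_Mapping.single 0 c * f) = Poly_Mapping.single 0 c * lin_ext h f"
  by (induction f rule: poly_mapping_linear_induct)
    (simp_all add: lin_ext_add mult_single distrib_left flip: mult.assoc)

lemma lin_ext_uminus: "lin_ext h (- f) = - lin_ext h f"
  using lin_ext_add[of h f "-f"] by (simp add: add_eq_0_iff)

lemma lin_ext_diff: "lin_ext h (f - g) = lin_ext h f - lin_ext h g"
  using lin_ext_add[of h f "-g"] by (simp add: lin_ext_uminus)

lemma lin_ext_word: "lin_ext h (word xs) = h (FMon xs)"
  by (simp add: word_def)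

lemma lin_ext_zero_fun: "(\<And>w. w \<in> Poly_Mapping.keys f \<Longrightarrow> h w = 0) \<Longrightarrow> lin_ext h f = 0"
  by (simp add: lin_ext_def)

lemma lin_ext_mult:
  fixes h :: "'m::monoid_add \<Rightarrow> 'n::monoid_add \<Rightarrow>\<^sub>0 complex"
  assumes "\<And>u v. h (u + v) = h u * h v"
  shows "lin_ext h (f * g) = lin_ext h f * lin_ext h g"
proof (induction f rule: poly_mapping_linear_induct)
  case (single u c)
  show ?case
  proof (induction g rule: poly_mapping_linear_induct)
    case (single v d)
    have "Poly_Mapping.single 0 (c * d) * (h u * h v) =
          Poly_Mapping.single 0 c * ((Poly_Mapping.single 0 d * h u) * h v)"
      by (simp add: mult_single flip: mult.assoc)
    also have "\<dots> = (Poly_Mapping.single 0 c * h u) * (Poly_Mapping.single 0 d * h v)"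
      by (metis mult.assoc single_zero_commute)
    finally show ?case by (simp add: mult_single assms)
  qed (simp_all add: lin_ext_add distrib_left)
qed (simp_all add: lin_ext_add distrib_right)

section \<open>Insertion and removal on semi-infinite wedges\<close>

type_synonym laurent = "int \<Rightarrow>\<^sub>0 complex"

abbreviation t_pow :: "int \<Rightarrow> laurent" where
  "t_pow k \<equiv> Poly_Mapping.single k 1"

text \<open>
  Counting along \<^const>\<open>int_encode\<close> keeps the set finite for every \<open>S\<close>; letting the condition
  on \<open>S\<close> depend on the sign of \<open>k\<close> makes the sign trivial on the vacua \<open>{..<c}\<close>.
\<close>

definition wedge_sign :: "int \<Rightarrow> int set \<Rightarrow> laurent" where
  "wedge_sign k S = (-1) ^ card {x. int_encode x < int_encode k \<and> (x \<in> S \<longleftrightarrow> k < 0)}"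

text \<open>Occupied positions and a charge. The charge is stored because an arbitrary set
  determines none; the relations hold on all pairs, and \<open>fock_state\<close> later selects the
  consistent ones.\<close>

type_synonym state = "int set \<times> int"

text \<open>Letting the position depend on the current charge absorbs the index shifts of the
  relations, so that plain anticommutation remains. The \<open>- 1\<close> for \<open>Ystar\<close>
  makes \<open>Ystar (- n)\<close> undo \<open>Y n\<close>, which has raised the charge by
  1.\<close>

fun gen_act :: "Agen \<Rightarrow> (state \<Rightarrow> laurent) \<Rightarrow> state \<Rightarrow> laurent" where
  "gen_act (Y n) g (S, c) =
     (if c - n \<in> S then 0 else wedge_sign (c - n) S * g (insert (c - n) S, c + 1))"
| "gen_act (Ystar n) g (S, c) =
     (if c - 1 + n \<in> S then wedge_sign (c - 1 + n) S * g (S - {c - 1 + n}, c - 1) else 0)"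

lemma wedge_sign_square: "wedge_sign k S * wedge_sign k S = 1"
  by (simp add: wedge_sign_def flip: power_add)

lemma wedge_sign_insert_same: "wedge_sign k (insert k S) = wedge_sign k S"
  unfolding wedge_sign_def by (rule arg_cong[where f = "\<lambda>A. (-1) ^ card A"]) auto

text \<open>If \<open>l\<close> is encoded below \<open>k\<close>, the counted set changes by
  exactly this element: it enters when \<open>k < 0\<close> and leaves otherwise. The parity flips
  either way.\<close>

lemma wedge_sign_insert:
  assumes "l \<notin> S" "k \<noteq> l"
  shows "wedge_sign k (insert l S) =
           (if int_encode l < int_encode k then - 1 else 1) * wedge_sign k S"
proof -
  define D where "D S = {x. int_encode x < int_encode k \<and> (x \<in> S \<longleftrightarrow> k < 0)}" for S
  have fin: "finite (D S)" for S
    by (rule finite_subset[of _ "int_encode -` {..<int_encode k}"])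
      (auto simp: D_def intro!: finite_vimageI inj_int_encode)
  have sign: "wedge_sign k S = (-1) ^ card (D S)" for S
    by (simp add: wedge_sign_def D_def)
  show ?thesis
  proof (cases "int_encode l < int_encode k")
    case False
    hence "D (insert l S) = D S" by (auto simp: D_def)
    thus ?thesis using False by (simp add: sign)
  next
    case True
    show ?thesis
    proof (cases "k < 0")
      case neg: True
      have "D (insert l S) = insert l (D S)" "l \<notin> D S"
        using True neg assms by (auto simp: D_def)
      thus ?thesis using True fin by (simp add: sign)
    next
      case nonneg: False
      have "D S = insert l (D (insert l S))" "l \<notin> D (insert l S)"
        using True nonneg assms by (auto simp: D_def)
      thus ?thesis using True fin by (simp add: sign)
    qed
  qed
qed

lemma wedge_sign_remove_same: "wedge_sign k (S - {k}) = wedge_sign k S"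
  by (metis insert_Diff_single wedge_sign_insert_same)

lemma wedge_sign_remove:
  assumes "l \<in> S" "k \<noteq> l"
  shows "wedge_sign k (S - {l}) =
           (if int_encode l < int_encode k then - 1 else 1) * wedge_sign k S"
  using wedge_sign_insert[of l "S - {l}" k] assms by (simp add: insert_absorb)

text \<open>The source of anticommutation: of two distinct positions exactly one is encoded below
  the other, so exactly one order of two moves picks up an extra sign.\<close>

lemma int_encode_less_antisym:
  "k \<noteq> l \<Longrightarrow> int_encode k < int_encode l \<longleftrightarrow> \<not> int_encode l < int_encode k"
  using inj_int_encode by (metis int_encode_eq linorder_neqE_nat not_less_iff_gr_or_eq)

text \<open>The letters appear reversed, as befits a right action. Both terms insert the same
  positions \<open>k\<close> and \<open>l\<close>, in opposite orders and hence with opposite signs;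
  if a position is occupied or \<open>k = l\<close>, both vanish.\<close>

lemma gen_act_Y_Y:
  "gen_act (Y n) (gen_act (Y m) g) \<sigma> + gen_act (Y (m - 1)) (gen_act (Y (n + 1)) g) \<sigma> = 0"
proof (cases \<sigma>)
  case (Pair S c)
  define k l where "k = c - n" and "l = c + 1 - m"
  have eqs: "c - n = k" "c + 1 - m = l" "c - (m - 1) = l" "c + 1 - (n + 1) = k"
    by (simp_all add: k_def l_def)
  show ?thesis
  proof (cases "k = l \<or> k \<in> S \<or> l \<in> S")
    case True
    thus ?thesis by (auto simp: Pair eqs)
  next
    case False
    thus ?thesis
      using int_encode_less_antisym[of k l]
      by (simp add: Pair eqs wedge_sign_insert insert_commute[of k l] mult.left_commute)
  qed
qed

lemma gen_act_Ystar_Ystar: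
  "gen_act (Ystar n) (gen_act (Ystar m) g) \<sigma> + gen_act (Ystar (m - 1)) (gen_act (Ystar (n + 1)) g) \<sigma> = 0"
proof (cases \<sigma>)
  case (Pair S c)
  define k l where "k = c - 1 + n" and "l = c - 1 - 1 + m"
  have eqs: "c - 1 + n = k" "c - 1 - 1 + m = l" "c - 1 + (m - 1) = l" "c - 1 - 1 + (n + 1) = k"
    by (simp_all add: k_def l_def)
  have "gen_act (Ystar n) (gen_act (Ystar m) g) (S, c) =
    (if k \<in> S \<and> l \<in> S \<and> k \<noteq> l then wedge_sign k S * (wedge_sign l (S - {k}) * g (S - {k} - {l}, c - 1 - 1)) else 0)"
    by (simp only: gen_act.simps eqs) auto
  moreover have "gen_act (Ystar (m - 1)) (gen_act (Ystar (n + 1)) g) (S, c) =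
    (if k \<in> S \<and> l \<in> S \<and> k \<noteq> l then wedge_sign l S * (wedge_sign k (S - {l}) * g (S - {l} - {k}, c - 1 - 1)) else 0)"
    by (simp only: gen_act.simps eqs) auto
  moreover have "S - {l} - {k} = S - {k} - {l}" by auto
  ultimately show ?thesis
    using int_encode_less_antisym[of k l]
    by (simp add: Pair wedge_sign_remove mult.left_commute)
qed

text \<open>For \<open>k = l\<close> exactly one term survives, depending on whether the position is
  occupied, and its two equal signs cancel to give the identity. For distinct positions the two
  moves anticommute.\<close>

lemma gen_act_Y_Ystar:
  "gen_act (Ystar n) (gen_act (Y m) g) \<sigma> + gen_act (Y (m + 1)) (gen_act (Ystar (n - 1)) g) \<sigma> =
     (if m + n = 0 then g \<sigma> else 0)"
proof (cases \<sigma>)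
  case (Pair S c)
  define k l where "k = c - 1 + n" and "l = c - 1 - m"
  have eqs: "c - 1 + n = k" "c - 1 - m = l" "c - (m + 1) = l" "c + (n - 1) = k"
      "c - 1 + 1 = c" "c + 1 - 1 = c"
    by (simp_all add: k_def l_def)
  have kl: "m + n = 0 \<longleftrightarrow> k = l" by (auto simp: k_def l_def)
  have 1: "gen_act (Ystar n) (gen_act (Y m) g) (S, c) =
    (if k \<in> S \<and> (l \<notin> S \<or> k = l) then wedge_sign k S * (wedge_sign l (S - {k}) * g (insert l (S - {k}), c)) else 0)"
    by (simp only: gen_act.simps eqs) auto
  have 2: "gen_act (Y (m + 1)) (gen_act (Ystar (n - 1)) g) (S, c) =
    (if l \<notin> S \<and> (k \<in> S \<or> k = l) then wedge_sign l S * (wedge_sign k (insert l S) * g (insert l S - {k}, c)) else 0)"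
    by (simp only: gen_act.simps eqs) auto
  show ?thesis
  proof (cases "k = l")
    case True
    have "insert k (S - {k}) = S" if "k \<in> S" using that by auto
    moreover have "insert k S - {k} = S" if "k \<notin> S" using that by auto
    ultimately show ?thesis
      using True unfolding Pair 1 2 kl
      by (simp add: wedge_sign_insert_same wedge_sign_remove_same wedge_sign_square
          flip: mult.assoc)
  next
    case False
    hence "insert l S - {k} = insert l (S - {k})" by auto
    thus ?thesis
      using False int_encode_less_antisym[of k l] unfolding Pair 1 2 kl
      by (simp add: wedge_sign_insert wedge_sign_remove mult.left_commute)
  qed
qed

abbreviation word_act :: "Agen list \<Rightarrow> (state \<Rightarrow> laurent) \<Rightarrow> state \<Rightarrow> laurent" where
  "word_act \<equiv> fold gen_act"

text \<open>
  A right action: it is dual to a representation on the fermionic Fock space, so functions are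
  transported along states and all sums stay finite.
\<close>

definition fock_act :: "Agen free \<Rightarrow> (state \<Rightarrow> laurent) \<Rightarrow> state \<Rightarrow> laurent" where
  "fock_act f g \<sigma> = lin_ext (\<lambda>w. word_act (letters w) g \<sigma>) f"

lemma gen_act_add: "gen_act x (\<lambda>\<sigma>. g \<sigma> + h \<sigma>) = (\<lambda>\<sigma>. gen_act x g \<sigma> + gen_act x h \<sigma>)"
  by (rule ext, cases x) (auto simp: distrib_left)

lemma gen_act_scale: "gen_act x (\<lambda>\<sigma>. a * g \<sigma>) = (\<lambda>\<sigma>. a * gen_act x g \<sigma>)"
  by (rule ext, cases x) (auto simp: mult.left_commute)

lemma gen_act_zero: "gen_act x (\<lambda>\<sigma>. 0) = (\<lambda>\<sigma>. 0)"
  by (rule ext, cases x) auto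

lemma word_act_add: "word_act xs (\<lambda>\<sigma>. g \<sigma> + h \<sigma>) = (\<lambda>\<sigma>. word_act xs g \<sigma> + word_act xs h \<sigma>)"
  by (induction xs arbitrary: g h) (simp_all add: gen_act_add)

lemma word_act_scale: "word_act xs (\<lambda>\<sigma>. a * g \<sigma>) = (\<lambda>\<sigma>. a * word_act xs g \<sigma>)"
  by (induction xs arbitrary: g) (simp_all add: gen_act_scale)

lemma word_act_zero: "word_act xs (\<lambda>\<sigma>. 0) = (\<lambda>\<sigma>. 0)"
  by (induction xs) (simp_all add: gen_act_zero)

lemma fock_act_word: "fock_act (word xs) g = word_act xs g"
  by (rule ext) (simp add: fock_act_def lin_ext_word)

lemma fock_act_add: "fock_act (f + f') g = (\<lambda>\<sigma>. fock_act f g \<sigma> + fock_act f' g \<sigma>)"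
  by (simp add: fock_act_def fun_eq_iff lin_ext_add)

lemma fock_act_diff: "fock_act (f - f') g = (\<lambda>\<sigma>. fock_act f g \<sigma> - fock_act f' g \<sigma>)"
  by (simp add: fock_act_def fun_eq_iff lin_ext_diff)

lemma fock_act_uminus: "fock_act (- f) g = (\<lambda>\<sigma>. - fock_act f g \<sigma>)"
  by (simp add: fock_act_def fun_eq_iff lin_ext_uminus)

lemma fock_act_zero_left: "fock_act 0 g = (\<lambda>\<sigma>. 0)"
  by (simp add: fock_act_def fun_eq_iff)

lemma fock_act_one: "fock_act 1 g = g"
  using fock_act_word[of "[]" g] by (simp add: word_Nil)

lemma fock_act_zero: "fock_act f (\<lambda>\<sigma>. 0) = (\<lambda>\<sigma>. 0)"
  by (rule ext) (simp add: fock_act_def word_act_zero lin_ext_zero_fun)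

lemma fock_act_mult: "fock_act (f * f') g = fock_act f' (fock_act f g)"
proof (rule ext)
  fix \<sigma>
  show "fock_act (f * f') g \<sigma> = fock_act f' (fock_act f g) \<sigma>"
  proof (induction f' rule: poly_mapping_linear_induct)
    case (single v d)
    show ?case
    proof (induction f rule: poly_mapping_linear_induct)
      case (single u c)
      show ?case
        by (simp add: fock_act_def mult_single plus_fmon_def word_act_scale flip: mult.assoc)
          (simp add: mult.commute)
    next
      case zero
      show ?case by (simp add: fock_act_def word_act_zero)
    next
      case (add f f')
      thus ?case
        by (simp add: fock_act_def[of "Poly_Mapping.single v d"] fock_act_add word_act_add distrib_left distrib_right)
    qed
  qed (simp_all add: fock_act_def lin_ext_add distrib_left)
qed

text \<open>Quantifying over all \<open>g\<close> makes the annihilator two-sided: for a factor on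
  the right, the zero function is fixed; for a factor on the left, \<open>f\<close> also kills the
  image of \<open>g\<close>.\<close>

lemma free_ideal_fock_kernel: "ideal {f. \<forall>g. fock_act f g = (\<lambda>\<sigma>. 0)} free_calg"
proof -
  interpret ring "free_calg :: Agen free calgebra" by (rule monoid_calg_ring)
  show ?thesis
    by (intro idealI monoid_calg_ring add.subgroupI)
      (auto simp: fock_act_mult fock_act_zero fock_act_add fock_act_uminus
        intro!: exI[of _ 0] fock_act_zero_left)
qed

lemma fock_act_A_rels:
  assumes "f \<in> Idl\<^bsub>free_calg\<^esub> A_rels"
  shows "fock_act f g = (\<lambda>\<sigma>. 0)"
proof -
  interpret ring "free_calg :: Agen free calgebra" by (rule monoid_calg_ring)
  have "A_rels \<subseteq> {f. \<forall>g. fock_act f g = (\<lambda>\<sigma>. 0)}"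
    by (auto simp: A_rels_def fock_act_add fock_act_diff fock_act_mult gen_eq_word fock_act_word fock_act_one
      gen_act_Y_Y gen_act_Ystar_Ystar gen_act_Y_Ystar fun_eq_iff simp del: gen_act.simps)
  with genideal_minimal[OF free_ideal_fock_kernel] assms show ?thesis by blast
qed

subsection \<open>Energy and the vacuum coefficient\<close>

fun gen_charge :: "Agen \<Rightarrow> int" where
  "gen_charge (Y n) = 1"
| "gen_charge (Ystar n) = -1"

fun vac :: "state \<Rightarrow> laurent" where
  "vac (S, c) = (if S = {..<c} then t_pow c else 0)"

text \<open>In dual terms, \<open>f\<close> is applied to the vacuum of charge 0 and the result
  projected to the span of all vacua, the charge being recorded as the exponent of
  \<open>t\<close>.\<close>

definition vac_coeff :: "Agen free \<Rightarrow> laurent" where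
  "vac_coeff f = fock_act f vac ({..<0}, 0)"

text \<open>No position is counted: for \<open>c < 0\<close> the occupied positions, and for
  \<open>c \<ge> 0\<close> the vacant ones other than \<open>c\<close>, lie farther from 0 on the
  same side as \<open>c\<close> and have larger codes.\<close>

lemma wedge_sign_vac: "wedge_sign c {..<c} = 1"
proof -
  have "{x. int_encode x < int_encode c \<and> (x \<in> {..<c} \<longleftrightarrow> c < 0)} = {}"
    by (auto simp: int_encode_def sum_encode_def)
  thus ?thesis unfolding wedge_sign_def by (simp only: card.empty power_0)
qed

text \<open>\<open>Y 0\<close> fills the first vacant position of a vacuum and
  \<open>Ystar 0\<close> empties the last occupied one, each with sign 1. The induction peels off
  the last letter because that one meets the state first.\<close>

lemma word_act_vac:
  assumes "\<And>x. x \<in> set xs \<Longrightarrow> gen_deg x = 0"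
  shows "word_act xs vac ({..<c}, c) = t_pow (c + sum_list (map gen_charge xs))"
  using assms
proof (induction xs arbitrary: c rule: rev_induct)
  case Nil
  show ?case by simp
next
  case (snoc x xs)
  have sets: "insert c {..<c} = {..<c + 1}" "{..<c} - {c - 1} = {..<c - 1}" "insert (c - 1) {..<c - 1} = {..<c}"
    by auto
  have sign: "wedge_sign (c - 1) {..<c} = 1"
    using wedge_sign_insert_same[of "c - 1" "{..<c - 1}"] by (simp add: sets wedge_sign_vac)
  have "x = Y 0 \<or> x = Ystar 0"
    using snoc.prems[of x] by (cases x) auto
  thus ?case
    using snoc by (auto simp: sets sign wedge_sign_vac algebra_simps)
qed

text \<open>The largest element is at least the number of the others, so the sum is bounded below by
  0 + 1 + ... up to \<open>card A - 1\<close>.\<close>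

lemma card_times_pred_le_sum:
  fixes A :: "int set"
  assumes "finite A" "\<And>x. x \<in> A \<Longrightarrow> 0 \<le> x"
  shows "int (card A) * (int (card A) - 1) \<le> 2 * \<Sum>A"
  using assms
proof (induction A rule: finite_linorder_max_induct)
  case empty
  show ?case by simp
next
  case (insert b A)
  have "A \<subseteq> {0..<b}" using insert by auto
  hence "int (card A) \<le> b"
    using card_mono[of "{0..<b}" A] insert.prems[of b] by simp
  hence "int (card A) * 2 \<le> b * 2" by simp
  moreover have "b \<notin> A" using insert by auto
  ultimately show ?case
    using insert by (simp add: algebra_simps)
qed

definition particles :: "int set \<Rightarrow> int set" where
  "particles S = {x \<in> S. 0 \<le> x}"

definition holes :: "int set \<Rightarrow> int set" where
  "holes S = {x. x < 0 \<and> x \<notin> S}"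

definition fock_state :: "state \<Rightarrow> bool" where
  "fock_state = (\<lambda>(S, c). finite (particles S) \<and> finite (holes S) \<and>
     c = int (card (particles S)) - int (card (holes S)))"

text \<open>Twice the energy, normalised so that the vacuum of every charge has energy 0.\<close>

definition energy2 :: "state \<Rightarrow> int" where
  "energy2 = (\<lambda>(S, c). 2 * (\<Sum>(particles S) - \<Sum>(holes S)) - c * (c - 1))"

text \<open>With \<open>p\<close> particles and \<open>h\<close> holes, twice the sum of the
  particles is at least \<open>p * (p - 1)\<close>. Reflecting holes by \<open>- x - 1\<close>
  bounds their contribution below by \<open>h * (h + 1)\<close>. Subtracting
  \<open>c * (c - 1)\<close> for \<open>c = p - h\<close> leaves at least
  \<open>2 * p * h\<close>.\<close>

lemma energy2_nonneg:
  assumes "fock_state \<sigma>"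
  shows "0 \<le> energy2 \<sigma>"
proof (cases \<sigma>)
  case (Pair S c)
  define p h where "p = int (card (particles S))" and "h = int (card (holes S))"
  have fin: "finite (particles S)" "finite (holes S)" and c: "c = p - h"
    using assms by (auto simp: Pair fock_state_def p_def h_def)
  have 1: "p * (p - 1) \<le> 2 * \<Sum>(particles S)"
    unfolding p_def using fin by (intro card_times_pred_le_sum) (auto simp: particles_def)
  have inj: "inj_on (\<lambda>x. - x - 1) (holes S)" by (auto simp: inj_on_def)
  have "int (card ((\<lambda>x. - x - 1) ` holes S)) * (int (card ((\<lambda>x. - x - 1) ` holes S)) - 1) \<le>
        2 * \<Sum>((\<lambda>x. - x - 1) ` holes S)"
    using fin by (intro card_times_pred_le_sum) (auto simp: holes_def)
  hence "h * (h - 1) \<le> 2 * (- \<Sum>(holes S) - h)"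
    using card_image[OF inj] by (simp add: h_def sum.reindex[OF inj] sum_subtractf sum_negf)
  moreover have "0 \<le> p * h" by (simp add: p_def h_def)
  ultimately show ?thesis
    using 1 by (simp add: energy2_def Pair c algebra_simps)
qed

text \<open>The new position becomes a particle or fills a hole. The sum grows by \<open>k\<close>
  in both cases, while \<open>c * (c - 1)\<close> grows by \<open>2 * c\<close>.\<close>

lemma fock_state_insert:
  assumes "fock_state (S, c)" "k \<notin> S"
  shows "fock_state (insert k S, c + 1)"
    and "energy2 (insert k S, c + 1) = energy2 (S, c) + 2 * (k - c)"
proof -
  have "finite (particles S)" "finite (holes S)"
    and c: "c = int (card (particles S)) - int (card (holes S))"
    using assms by (simp_all add: fock_state_def)
  note assms' = this
  consider "0 \<le> k" | "k < 0" by linarith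
  then have "fock_state (insert k S, c + 1) \<and> energy2 (insert k S, c + 1) = energy2 (S, c) + 2 * (k - c)"
  proof cases
    case 1
    have "particles (insert k S) = insert k (particles S)" "holes (insert k S) = holes S"
        "k \<notin> particles S"
      using 1 assms by (auto simp: particles_def holes_def)
    with assms' show ?thesis
      by (simp add: fock_state_def energy2_def algebra_simps)
  next
    case 2
    define H where "H = holes (insert k S)"
    have "particles (insert k S) = particles S" "holes S = insert k H" "k \<notin> H"
      using 2 assms by (auto simp: particles_def holes_def H_def)
    with assms' show ?thesis
      by (simp add: fock_state_def energy2_def algebra_simps flip: H_def)
  qed
  thus "fock_state (insert k S, c + 1)" "energy2 (insert k S, c + 1) = energy2 (S, c) + 2 * (k - c)"
    by auto
qed

lemma fock_state_remove:
  assumes "fock_state (S, c)" "k \<in> S"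
  shows "fock_state (S - {k}, c - 1)"
    and "energy2 (S - {k}, c - 1) = energy2 (S, c) + 2 * (c - 1 - k)"
proof -
  have "finite (particles S)" "finite (holes S)"
    and c: "c = int (card (particles S)) - int (card (holes S))"
    using assms by (simp_all add: fock_state_def)
  note assms' = this
  consider "0 \<le> k" | "k < 0" by linarith
  then have *: "fock_state (S - {k}, c - 1)"
  proof cases
    case 1
    define P where "P = particles (S - {k})"
    have "particles S = insert k P" "k \<notin> P" "holes (S - {k}) = holes S"
      using 1 assms by (auto simp: particles_def holes_def P_def)
    with assms' show ?thesis by (simp add: fock_state_def flip: P_def)
  next
    case 2
    have "particles (S - {k}) = particles S" "holes (S - {k}) = insert k (holes S)" "k \<notin> holes S"
      using 2 assms by (auto simp: particles_def holes_def)
    with assms' show ?thesis by (simp add: fock_state_def)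
  qed
  thus "fock_state (S - {k}, c - 1)" .
  show "energy2 (S - {k}, c - 1) = energy2 (S, c) + 2 * (c - 1 - k)"
    using fock_state_insert(2)[OF *, of k] assms by (simp add: insert_absorb)
qed

text \<open>A generator moves a state along at most one arrow. The sign and the target do not depend
  on \<open>g\<close>, which is what an induction along a word needs.\<close>

lemma gen_act_fock_state:
  assumes "fock_state \<sigma>"
  obtains \<epsilon> \<sigma>' where "fock_state \<sigma>'" "energy2 \<sigma>' = energy2 \<sigma> + 2 * gen_deg x" "\<And>g. gen_act x g \<sigma> = \<epsilon> * g \<sigma>'"
  | "\<And>g. gen_act x g \<sigma> = 0"
proof (cases \<sigma>)
  case (Pair S c)
  show ?thesis
  proof (cases x)
    case (Y n)
    show ?thesis
    proof (cases "c - n \<in> S")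
      case True
      thus ?thesis by (intro that(2)) (simp add: Pair Y)
    next
      case False
      thus ?thesis
        using fock_state_insert[of S c "c - n"] assms
        by (intro that(1)[of "(insert (c - n) S, c + 1)" "wedge_sign (c - n) S"]) (simp_all add: Pair Y)
    qed
  next
    case (Ystar n)
    show ?thesis
    proof (cases "c - 1 + n \<in> S")
      case True
      thus ?thesis
        using fock_state_remove[of S c "c - 1 + n"] assms
        by (intro that(1)[of "(S - {c - 1 + n}, c - 1)" "wedge_sign (c - 1 + n) S"])
          (simp_all add: Pair Ystar)
    next
      case False
      thus ?thesis by (intro that(2)) (simp add: Pair Ystar)
    qed
  qed
qed

text \<open>Otherwise the word would lead from \<open>\<sigma>\<close> to a Fock state of negative
  energy.\<close>

lemma word_act_negative_energy:
  assumes "fock_state \<sigma>" "energy2 \<sigma> + 2 * sum_list (map gen_deg xs) < 0"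
  shows "word_act xs g \<sigma> = 0"
  using assms
proof (induction xs arbitrary: \<sigma> rule: rev_induct)
  case Nil
  thus ?case using energy2_nonneg[of \<sigma>] by simp
next
  case (snoc x xs)
  show ?case
    using snoc.prems(1)
  proof (cases rule: gen_act_fock_state[where x = x])
    case (1 \<epsilon> \<sigma>')
    thus ?thesis using snoc.IH[of \<sigma>'] snoc.prems by simp
  qed simp
qed

lemma fock_state_vac: "fock_state ({..<0}, 0)" "energy2 ({..<0}, 0) = 0"
proof -
  have "particles {..<0} = {}" "holes {..<0} = {}" by (auto simp: particles_def holes_def)
  thus "fock_state ({..<0}, 0)" "energy2 ({..<0}, 0) = 0"
    unfolding fock_state_def energy2_def prod.case by simp_all
qed

section \<open>Homogeneous elements and the vacuum coefficient\<close>

definition homogeneous :: "int \<Rightarrow> Agen free set" where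
  "homogeneous n = {f. \<forall>w \<in> Poly_Mapping.keys f. word_deg w = n}"

text \<open>The right factor meets the vacuum first, and no state lies below energy 0.\<close>

lemma vac_coeff_mult_negative:
  assumes "f' \<in> homogeneous n" "n < 0"
  shows "vac_coeff (f * f') = 0"
proof -
  have "fock_act f' g ({..<0}, 0) = 0" for g
    unfolding fock_act_def using assms fock_state_vac
    by (intro lin_ext_zero_fun word_act_negative_energy) (auto simp: homogeneous_def word_deg_def)
  thus ?thesis by (simp add: vac_coeff_def fock_act_mult)
qed

lemma vac_coeff_linear:
  "vac_coeff 0 = 0"
  "vac_coeff (f + f') = vac_coeff f + vac_coeff f'"
  "vac_coeff (f - f') = vac_coeff f - vac_coeff f'"
  "vac_coeff (Poly_Mapping.single 0 c * f) = Poly_Mapping.single 0 c * vac_coeff f"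
  by (simp_all add: vac_coeff_def fock_act_def lin_ext_add lin_ext_diff lin_ext_smult)

lemma vac_coeff_A_rels: "f \<in> Idl\<^bsub>free_calg\<^esub> A_rels \<Longrightarrow> vac_coeff f = 0"
  by (simp add: vac_coeff_def fock_act_A_rels)

lemma vac_coeff_word:
  assumes "\<And>x. x \<in> set xs \<Longrightarrow> gen_deg x = 0"
  shows "vac_coeff (word xs) = t_pow (sum_list (map gen_charge xs))"
  using word_act_vac[of xs 0] assms by (simp add: vac_coeff_def fock_act_word)

subsection \<open>Reduction to normal words\<close>

abbreviation letters_deg :: "Agen list \<Rightarrow> int" where
  "letters_deg xs \<equiv> sum_list (map gen_deg xs)"

lemma homogeneous_zero: "0 \<in> homogeneous n"
  by (simp add: homogeneous_def)

lemma homogeneous_word: "letters_deg xs = n \<Longrightarrow> word xs \<in> homogeneous n"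
  by (simp add: homogeneous_def word_def word_deg_def)

lemma homogeneous_one: "1 \<in> homogeneous 0"
  using homogeneous_word[of "[]"] by (simp add: word_Nil)

lemma homogeneous_gen: "gen x \<in> homogeneous (gen_deg x)"
  using homogeneous_word[of "[x]"] by (simp add: gen_eq_word)

lemma homogeneous_add: "f \<in> homogeneous n \<Longrightarrow> g \<in> homogeneous n \<Longrightarrow> f + g \<in> homogeneous n"
  using keys_add[of f g] by (auto simp: homogeneous_def)

lemma homogeneous_mult:
  assumes "f \<in> homogeneous m" "g \<in> homogeneous n"
  shows "f * g \<in> homogeneous (m + n)"
  using keys_mult[of f g] assms by (force simp: homogeneous_def word_deg_def plus_fmon_def)

lemma homogeneous_smult:
  "f \<in> homogeneous n \<Longrightarrow> Poly_Mapping.single 0 c * f \<in> homogeneous n"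
  using homogeneous_mult[of "Poly_Mapping.single 0 c" 0 f n]
  by (simp add: homogeneous_def word_deg_def zero_fmon_def)

lemma homogeneous_diff: "f \<in> homogeneous n \<Longrightarrow> g \<in> homogeneous n \<Longrightarrow> f - g \<in> homogeneous n"
  using keys_diff[of f g] by (auto simp: homogeneous_def)

lemma A_rels_Idl:
  shows "ideal (Idl\<^bsub>free_calg\<^esub> A_rels) free_calg"
    and "f \<in> A_rels \<Longrightarrow> f \<in> Idl\<^bsub>free_calg\<^esub> A_rels"
proof -
  interpret ring "free_calg :: Agen free calgebra" by (rule monoid_calg_ring)
  show "ideal (Idl\<^bsub>free_calg\<^esub> A_rels) free_calg" by (rule genideal_ideal) simp
  show "f \<in> A_rels \<Longrightarrow> f \<in> Idl\<^bsub>free_calg\<^esub> A_rels" using genideal_self[of A_rels] by auto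
qed

lemma free_ideal_closed:
  assumes "ideal I (free_calg :: 'g free calgebra)"
  shows "0 \<in> I" "f \<in> I \<Longrightarrow> g \<in> I \<Longrightarrow> f + g \<in> I" "f \<in> I \<Longrightarrow> g * f \<in> I" "f \<in> I \<Longrightarrow> f * g \<in> I"
    "f \<in> I \<Longrightarrow> g \<in> I \<Longrightarrow> f - g \<in> I"
proof -
  interpret ideal I "free_calg :: 'g free calgebra" by fact
  show "0 \<in> I" "f \<in> I \<Longrightarrow> g \<in> I \<Longrightarrow> f + g \<in> I" "f \<in> I \<Longrightarrow> g * f \<in> I" "f \<in> I \<Longrightarrow> f * g \<in> I"
    using additive_subgroup.zero_closed[OF is_additive_subgroup]
      additive_subgroup.a_closed[OF is_additive_subgroup, of f g] I_l_closed[of f g] I_r_closed[of f g] by auto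
  show "f \<in> I \<Longrightarrow> g \<in> I \<Longrightarrow> f - g \<in> I"
    using additive_subgroup.a_closed[OF is_additive_subgroup, of f "-g"]
      additive_subgroup.a_inv_closed[OF is_additive_subgroup, of g] by simp
qed

lemmas A_Idl_closed = free_ideal_closed[OF A_rels_Idl(1)]

text \<open>
  Shifting each degree by the product of the charges turns the relations into those of a
  Clifford algebra.
\<close>

lemma exchange:
  obtains x' y' where
    "gen x * gen y + gen y' * gen x' -
       (if gen_charge x \<noteq> gen_charge y \<and> gen_deg x + gen_deg y = 0 then 1 else 0) \<in> Idl\<^bsub>free_calg\<^esub> A_rels"
    "gen_deg y' = gen_deg y - gen_charge x * gen_charge y"
    "gen_deg x' = gen_deg x + gen_charge x * gen_charge y"
    "gen_charge x = gen_charge y \<Longrightarrow> gen_deg y = gen_deg x + 1 \<Longrightarrow> x' = y \<and> y' = x"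
proof (cases x; cases y)
  fix m n assume xy: "x = Y m" "y = Y n"
  have "gen (Y m) * gen (Y n) + gen (Y (n + 1)) * gen (Y (m - 1)) \<in> A_rels"
    by (auto simp: A_rels_def)
  thus thesis
    using A_rels_Idl(2) by (intro that[of "Y (n + 1)" "Y (m - 1)"]) (auto simp: xy)
next
  fix m n assume xy: "x = Ystar m" "y = Ystar n"
  have "gen (Ystar m) * gen (Ystar n) + gen (Ystar (n + 1)) * gen (Ystar (m - 1)) \<in> A_rels"
    by (auto simp: A_rels_def)
  thus thesis
    using A_rels_Idl(2) by (intro that[of "Ystar (n + 1)" "Ystar (m - 1)"]) (auto simp: xy)
next
  fix m n assume xy: "x = Y m" "y = Ystar n"
  have "gen (Y m) * gen (Ystar n) + gen (Ystar (n - 1)) * gen (Y (m + 1)) - (if m + n = 0 then 1 else 0) \<in> A_rels"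
    unfolding A_rels_def by blast
  moreover have "m + n = 0 \<longleftrightarrow> - m - n = 0" by auto
  ultimately show thesis
    using A_rels_Idl(2) by (intro that[of "Ystar (n - 1)" "Y (m + 1)"]) (auto simp: xy)
next
  fix m n assume xy: "x = Ystar m" "y = Y n"
  \<comment> \<open>At the indices \<open>n - 1\<close> and \<open>m + 1\<close> the second product
    of the mixed relation is \<open>gen x * gen y\<close>.\<close>
  have "gen (Y (n - 1)) * gen (Ystar (m + 1)) + gen (Ystar (m + 1 - 1)) * gen (Y (n - 1 + 1)) -
      (if (n - 1) + (m + 1) = 0 then 1 else 0) \<in> A_rels"
    unfolding A_rels_def by blast
  moreover have "n + m = 0 \<longleftrightarrow> - m - n = 0" by auto
  ultimately show thesis
    using A_rels_Idl(2) by (intro that[of "Y (n - 1)" "Ystar (m + 1)"]) (auto simp: xy add.commute)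
qed

section \<open>Spanning by normal words\<close>

fun normal :: "Agen list \<Rightarrow> bool" where
  "normal [] = True"
| "normal (x # xs) = (gen_deg x > 0 \<and> normal xs \<or> (\<forall>y\<in>set (x # xs). gen_deg y = 0))"

text \<open>
  The rule \<open>negative\<close> accounts for the left ideal generated by the elements of negative degree.
\<close>

inductive_set normal_span :: "int \<Rightarrow> nat \<Rightarrow> Agen free set" for d :: int and L :: nat where
  rel: "r \<in> Idl\<^bsub>free_calg\<^esub> A_rels \<Longrightarrow> r \<in> homogeneous d \<Longrightarrow> r \<in> normal_span d L"
| negative: "letters_deg ys < 0 \<Longrightarrow> letters_deg (xs @ ys) = d \<Longrightarrow> word (xs @ ys) \<in> normal_span d L"
| normal: "normal xs \<Longrightarrow> length xs \<le> L \<Longrightarrow> letters_deg xs = d \<Longrightarrow> word xs \<in> normal_span d L"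
| add: "f \<in> normal_span d L \<Longrightarrow> g \<in> normal_span d L \<Longrightarrow> f + g \<in> normal_span d L"
| smult: "f \<in> normal_span d L \<Longrightarrow> Poly_Mapping.single 0 c * f \<in> normal_span d L"

lemma normal_span_diff:
  assumes "f \<in> normal_span d L" "g \<in> normal_span d L"
  shows "f - g \<in> normal_span d L"
  using normal_span.add[OF assms(1) normal_span.smult[OF assms(2), of "-1"]]
  by (simp add: single_uminus)

text \<open>Left multiplication respects every rule except \<open>normal\<close>; in
  \<open>negative\<close> the part of negative degree stands on the right and is untouched. So only
  normal words need checking.\<close>

lemma gen_mult_normal_span:
  assumes "f \<in> normal_span d L"
    and "\<And>ys. normal ys \<Longrightarrow> length ys \<le> L \<Longrightarrow> letters_deg ys = d \<Longrightarrow> word (x # ys) \<in> normal_span e M"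
    and e: "e = gen_deg x + d"
  shows "gen x * f \<in> normal_span e M"
  using assms(1)
proof induction
  case (rel r)
  thus ?case
    unfolding e by (intro normal_span.rel A_Idl_closed(3) homogeneous_mult homogeneous_gen)
next
  case (negative ys xs)
  thus ?case
    using normal_span.negative[of ys "x # xs" e M] by (simp add: word_Cons e)
next
  case (normal xs)
  thus ?case using assms(2) by (simp add: word_Cons)
next
  case (add f g)
  thus ?case by (simp add: distrib_left normal_span.add)
next
  case (smult f c)
  have "gen x * (Poly_Mapping.single 0 c * f) = Poly_Mapping.single 0 c * (gen x * f)"
    by (metis mult.assoc single_zero_commute)
  thus ?case using smult by (simp add: normal_span.smult)
qed

text \<open>The work arises when a nonpositive \<open>x\<close> precedes a positive
  \<open>y\<close>: the exchange puts \<open>y'\<close> in front of a shorter word already covered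
  by \<open>IH\<close>. If \<open>y'\<close> drops to degree 0, \<open>zero\<close> takes over.
  Restricting \<open>zero\<close> to negative \<open>x\<close> allows the lemma to be used twice,
  first for letters of degree 0 and then for all.\<close>

lemma word_Cons_normal_span_step:
  assumes IH: "\<And>x ys. normal ys \<Longrightarrow> length ys < L \<Longrightarrow>
      word (x # ys) \<in> normal_span (letters_deg (x # ys)) (Suc (length ys))"
    and zero: "\<And>z ws. gen_deg x < 0 \<Longrightarrow> gen_deg z = 0 \<Longrightarrow> normal ws \<Longrightarrow> length ws \<le> L \<Longrightarrow>
      word (z # ws) \<in> normal_span (letters_deg (z # ws)) (Suc L)"
    and ys: "normal ys" "length ys = L"
  shows "word (x # ys) \<in> normal_span (letters_deg (x # ys)) (Suc L)"
proof (cases "\<forall>y\<in>set ys. gen_deg y = 0")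
  case True
  hence "letters_deg ys = 0" by (induction ys) auto
  \<comment> \<open>The tail has degree 0, so a negative \<open>x\<close> makes the whole word
    negative, with an empty left part.\<close>
  consider "gen_deg x < 0" | "normal (x # ys)"
    using True ys by force
  thus ?thesis
  proof cases
    case 1
    thus ?thesis
      using normal_span.negative[of "x # ys" "[]"] \<open>letters_deg ys = 0\<close> by simp
  next
    case 2
    thus ?thesis using ys by (intro normal_span.normal) auto
  qed
next
  case False
  then obtain y zs where y: "ys = y # zs" "gen_deg y > 0" "normal zs"
    using ys by (cases ys) auto
  show ?thesis
  proof (cases "gen_deg x > 0")
    case True
    thus ?thesis using ys by (intro normal_span.normal) auto
  next
    case False
    define \<delta> :: "Agen free" where
      "\<delta> = (if gen_charge x \<noteq> gen_charge y \<and> gen_deg x + gen_deg y = 0 then 1 else 0)"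
    obtain x' y' where rel: "gen x * gen y + gen y' * gen x' - \<delta> \<in> Idl\<^bsub>free_calg\<^esub> A_rels"
      and deg: "gen_deg y' = gen_deg y - gen_charge x * gen_charge y"
        "gen_deg x' = gen_deg x + gen_charge x * gen_charge y"
      and same: "gen_charge x = gen_charge y \<Longrightarrow> gen_deg y = gen_deg x + 1 \<Longrightarrow> x' = y \<and> y' = x"
      unfolding \<delta>_def by (rule exchange[of x y]) blast
    let ?d = "letters_deg (x # ys)"
    have d: "?d = gen_deg y' + letters_deg (x' # zs)"
      using deg by (simp add: y)
    have "gen_deg y' + gen_deg x' = gen_deg x + gen_deg y"
      using deg by simp
    hence hom: "gen x * gen y + gen y' * gen x' - \<delta> \<in> homogeneous (gen_deg x + gen_deg y)"
      using homogeneous_mult[OF homogeneous_gen homogeneous_gen, of x y]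
        homogeneous_mult[OF homogeneous_gen homogeneous_gen, of y' x']
      by (auto simp: \<delta>_def homogeneous_one homogeneous_zero intro!: homogeneous_diff homogeneous_add)
    have 1: "(gen x * gen y + gen y' * gen x' - \<delta>) * word zs \<in> normal_span ?d (Suc L)"
      using homogeneous_mult[OF hom homogeneous_word[OF refl, of zs]] rel
      by (intro normal_span.rel A_Idl_closed(4)) (auto simp: y add.assoc)
    have 2: "\<delta> * word zs \<in> normal_span ?d (Suc L)"
    proof (cases "\<delta> = 0")
      case True
      thus ?thesis
        by (intro normal_span.rel) (simp_all add: A_Idl_closed(1) homogeneous_zero)
    next
      case False
      hence "\<delta> = 1" "gen_deg x + gen_deg y = 0" by (auto simp: \<delta>_def split: if_splits)
      hence "word zs \<in> normal_span ?d (Suc L)"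
        using y ys by (intro normal_span.normal) auto
      thus ?thesis by (simp add: \<open>\<delta> = 1\<close>)
    qed
    have inner: "word (x' # zs) \<in> normal_span (letters_deg (x' # zs)) L"
      using IH[of zs x'] ys y by simp
    have split: "word (x # ys) = (gen x * gen y + gen y' * gen x' - \<delta>) * word zs
        - gen y' * word (x' # zs) + \<delta> * word zs"
      by (simp add: word_Cons y algebra_simps)
    \<comment> \<open>With equal charges and degrees 0 and 1 the exchange returns the same product,
      so the word is half a relator times \<open>word zs\<close>.\<close>
    show ?thesis
    proof (cases "gen_charge x = gen_charge y \<and> gen_deg x = 0 \<and> gen_deg y = 1")
      case True
      have "\<delta> = 0" "x' = y" "y' = x"
        using True same by (auto simp: \<delta>_def)
      moreover have "Poly_Mapping.single 0 (1 / 2) * (f + f) = f" for f :: "Agen free"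
        by (simp add: distrib_left flip: distrib_right single_add)
      ultimately have "word (x # ys) =
          Poly_Mapping.single 0 (1 / 2) * ((gen x * gen y + gen y' * gen x' - \<delta>) * word zs)"
        by (simp add: word_Cons y mult.assoc distrib_right)
      thus ?thesis using 1 by (simp add: normal_span.smult)
    next
      case not_square: False
      have "gen y' * word (x' # zs) \<in> normal_span ?d (Suc L)"
      proof (rule gen_mult_normal_span[OF inner _ d])
        fix ws assume ws: "normal ws" "length ws \<le> L" "letters_deg ws = letters_deg (x' # zs)"
        have d': "?d = letters_deg (y' # ws)" using ws(3) d by simp
        \<comment> \<open>Equal charges lower the degree of \<open>y\<close> by 1, opposite ones
          raise it. Degree 0 thus forces degree 1 for \<open>y\<close> and equal charges, and then
          \<open>x\<close> is negative by the case assumption.\<close>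
        consider "gen_deg y' > 0" | "gen_deg y' = 0" "gen_deg x < 0"
          using deg not_square \<open>\<not> gen_deg x > 0\<close> y(2) by (cases x; cases y) force+
        thus "word (y' # ws) \<in> normal_span ?d (Suc L)"
        proof cases
          case 1
          thus ?thesis unfolding d' using ws by (intro normal_span.normal) auto
        next
          case 2
          thus ?thesis unfolding d' using ws by (intro zero) auto
        qed
      qed
      with 1 2 show ?thesis
        unfolding split by (intro normal_span.add normal_span_diff)
    qed
  qed
qed

lemma normal_span_mono:
  assumes "f \<in> normal_span d L" "L \<le> M"
  shows "f \<in> normal_span d M"
  using assms by induction (auto intro: normal_span.intros)

lemma word_Cons_normal_span:
  "normal ys \<Longrightarrow> word (x # ys) \<in> normal_span (letters_deg (x # ys)) (Suc (length ys))"
proof (induction "length ys" arbitrary: x ys rule: less_induct)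
  case less
  have IH: "word (z # ws) \<in> normal_span (letters_deg (z # ws)) (Suc (length ws))"
    if "normal ws" "length ws < length ys" for z ws
    using less.hyps that by blast
  \<comment> \<open>For a letter of degree 0 the premise on negative \<open>x\<close> is vacuous;
    the result supplies this premise for arbitrary \<open>x\<close>.\<close>
  have zero: "word (z # ws) \<in> normal_span (letters_deg (z # ws)) (Suc (length ys))"
    if "gen_deg z = 0" "normal ws" "length ws = length ys" for z ws
  proof (rule word_Cons_normal_span_step)
    show "word (a # bs) \<in> normal_span (letters_deg (a # bs)) (Suc (length ys))"
      if "gen_deg z < 0" for a bs
      using that \<open>gen_deg z = 0\<close> by simp
  qed (fact IH that)+
  show ?case
  proof (rule word_Cons_normal_span_step)
    show "word (z # ws) \<in> normal_span (letters_deg (z # ws)) (Suc (length ys))"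
      if "gen_deg z = 0" "normal ws" "length ws \<le> length ys" for z ws
    proof (cases "length ws = length ys")
      case True
      thus ?thesis using that zero by blast
    next
      case False
      thus ?thesis
        using that by (intro normal_span_mono[OF IH]) auto
    qed
  qed (fact IH less.prems refl)+
qed

lemma word_normal_span: "word xs \<in> normal_span (letters_deg xs) (length xs)"
proof (induction xs)
  case Nil
  show ?case by (intro normal_span.normal) auto
next
  case (Cons x xs)
  show ?case
    unfolding word_Cons[of x]
  proof (rule gen_mult_normal_span[OF Cons])
    fix ys assume "normal ys" "length ys \<le> length xs" "letters_deg ys = letters_deg xs"
    thus "word (x # ys) \<in> normal_span (letters_deg (x # xs)) (length (x # xs))"
      using normal_span_mono[OF word_Cons_normal_span[of ys x], of "length (x # xs)"] by simp
  qed simp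
qed

subsection \<open>Presented algebras and Laurent polynomials\<close>

lemma presented_class_simps:
  fixes R :: "'g free set"
  shows "carrier (presented_calg R) = range (presented_class R)"
    and "presented_class R f \<oplus>\<^bsub>presented_calg R\<^esub> presented_class R g = presented_class R (f + g)"
    and "presented_class R f \<otimes>\<^bsub>presented_calg R\<^esub> presented_class R g = presented_class R (f * g)"
    and "\<one>\<^bsub>presented_calg R\<^esub> = presented_class R 1"
    and "\<zero>\<^bsub>presented_calg R\<^esub> = presented_class R 0"
    and "c \<odot>\<^bsub>presented_calg R\<^esub> presented_class R f = presented_class R (Poly_Mapping.single 0 c * f)"
    and "presented_class R f = presented_class R g \<longleftrightarrow> f - g \<in> Idl\<^bsub>free_calg\<^esub> R"
    and "calg (presented_calg R)"
    and "ideal (Idl\<^bsub>free_calg\<^esub> R) free_calg"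
proof -
  interpret calg "free_calg :: 'g free calgebra" by (rule monoid_calg_calg)
  have ideal: "ideal (Idl\<^bsub>free_calg\<^esub> R) free_calg" by (rule genideal_ideal) simp
  note S = quot_simps[OF ideal, simplified]
  show "carrier (presented_calg R) = range (presented_class R)"
    "presented_class R f \<oplus>\<^bsub>presented_calg R\<^esub> presented_class R g = presented_class R (f + g)"
    "presented_class R f \<otimes>\<^bsub>presented_calg R\<^esub> presented_class R g = presented_class R (f * g)"
    "\<one>\<^bsub>presented_calg R\<^esub> = presented_class R 1"
    "\<zero>\<^bsub>presented_calg R\<^esub> = presented_class R 0"
    "c \<odot>\<^bsub>presented_calg R\<^esub> presented_class R f = presented_class R (Poly_Mapping.single 0 c * f)"
    by (simp_all add: presented_calg_def presented_class_def S image_def)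
  show "presented_class R f = presented_class R g \<longleftrightarrow> f - g \<in> Idl\<^bsub>free_calg\<^esub> R"
    using coset_eq_iff[OF ideal, of f g] by (simp add: presented_class_def)
  show "calg (presented_calg R)"
    unfolding presented_calg_def by (rule quot_calg[OF ideal])
  show "ideal (Idl\<^bsub>free_calg\<^esub> R) free_calg" by (rule ideal)
qed

section \<open>Powers of two mutually inverse letters\<close>

definition power_word :: "'g \<Rightarrow> 'g \<Rightarrow> int \<Rightarrow> 'g list" where
  "power_word y y' k = (if 0 \<le> k then replicate (nat k) y else replicate (nat (- k)) y')"

lemma power_word_set: "set (power_word y y' k) \<subseteq> {y, y'}"
  by (auto simp: power_word_def)

lemma sum_list_power_word:
  assumes "q y = 1" "q y' = -1"
  shows "sum_list (map q (power_word y y' k)) = (k :: int)"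
  using assms by (simp add: power_word_def sum_list_replicate)

text \<open>A new first letter either lengthens the power or forms a cancelling pair at the front;
  the difference is then a relator times a power.\<close>

lemma power_word_Cons:
  "word (y # power_word y y' k) = word (power_word y y' (k + 1)) \<or>
   (\<exists>n. word (y # power_word y y' k) - word (power_word y y' (k + 1)) =
      (gen y * gen y' - 1) * word (replicate n y'))"
proof (cases "0 \<le> k")
  case True
  thus ?thesis by (simp add: power_word_def nat_add_distrib)
next
  case False
  define n where "n = nat (- k - 1)"
  have "power_word y y' k = y' # replicate n y'"
    using False by (simp add: power_word_def n_def flip: replicate_Suc)
  moreover have "power_word y y' (k + 1) = replicate n y'"
    using False by (auto simp: power_word_def n_def)
  ultimately have "word (y # power_word y y' k) - word (power_word y y' (k + 1)) =
      (gen y * gen y' - 1) * word (replicate n y')"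
    by (simp add: word_Cons algebra_simps)
  thus ?thesis by blast
qed

lemma power_word_Cons':
  "word (y' # power_word y y' k) = word (power_word y y' (k - 1)) \<or>
   (\<exists>n. word (y' # power_word y y' k) - word (power_word y y' (k - 1)) =
      (gen y' * gen y - 1) * word (replicate n y))"
proof -
  have "power_word y y' j = power_word y' y (- j)" for j
    by (simp add: power_word_def)
  thus ?thesis using power_word_Cons[of y' y "- k"] by simp
qed

text \<open>Only closure properties that survive in the degree 0 part are assumed of \<open>N\<close>.\<close>

lemma word_diff_power_word_mem:
  fixes q :: "'g \<Rightarrow> int"
  assumes q: "q y = 1" "q y' = -1"
    and N: "0 \<in> N" "\<And>f g. f \<in> N \<Longrightarrow> g \<in> N \<Longrightarrow> f + g \<in> N"
      "\<And>x f. x \<in> {y, y'} \<Longrightarrow> f \<in> N \<Longrightarrow> gen x * f \<in> N"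
      "\<And>x f n. x \<in> {y, y'} \<Longrightarrow> f \<in> N \<Longrightarrow> f * word (replicate n x) \<in> N"
      "gen y * gen y' - 1 \<in> N" "gen y' * gen y - 1 \<in> N"
    and "set xs \<subseteq> {y, y'}"
  shows "word xs - word (power_word y y' (sum_list (map q xs))) \<in> N"
  using assms(9)
proof (induction xs)
  case Nil
  thus ?case using N by (simp add: power_word_def)
next
  case (Cons x xs)
  define k where "k = sum_list (map q xs)"
  have IH: "gen x * (word xs - word (power_word y y' k)) \<in> N"
    using Cons by (intro N) (auto simp: k_def)
  have split: "word (x # xs) - w = gen x * (word xs - word (power_word y y' k))
      + (word (x # power_word y y' k) - w)" for w
    by (simp add: word_Cons algebra_simps)
  have "word (x # power_word y y' k) - word (power_word y y' (q x + k)) \<in> N"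
  proof (cases "x = y")
    case True
    thus ?thesis
      using power_word_Cons[of y y' k] N(1,4,5) q by (auto simp: add.commute)
  next
    case False
    hence "x = y'" using Cons.prems by auto
    thus ?thesis
      using power_word_Cons'[of y' y k] N(1,4,6) q by auto
  qed
  with IH show ?case by (simp add: split N k_def)
qed

text \<open>A linear section of \<open>vac_coeff\<close> and \<open>B_eval\<close>. It is not
  multiplicative for distinct letters, since the free algebra has no cancellation.\<close>

definition laurent_section :: "'g \<Rightarrow> 'g \<Rightarrow> laurent \<Rightarrow> 'g free" where
  "laurent_section y y' = lin_ext (\<lambda>k. word (power_word y y' k))"

lemma laurent_section_t_pow: "laurent_section y y' (t_pow k) = word (power_word y y' k)"
  by (simp add: laurent_section_def)

lemma laurent_section_linear:
  "laurent_section y y' 0 = 0"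
  "laurent_section y y' (p + q) = laurent_section y y' p + laurent_section y y' q"
  "laurent_section y y' (Poly_Mapping.single 0 c * p) = Poly_Mapping.single 0 c * laurent_section y y' p"
  by (simp_all add: laurent_section_def lin_ext_add lin_ext_smult)

lemma laurent_single: "Poly_Mapping.single k c = Poly_Mapping.single 0 c * t_pow k" for c :: complex
  by (simp add: mult_single)

subsection \<open>The degree zero quotient\<close>

abbreviation A_class :: "Agen free \<Rightarrow> Agen free set" where
  "A_class \<equiv> presented_class A_rels"

interpretation A: calg A_alg
  unfolding A_alg_def by (rule presented_class_simps(8))

lemmas A_simps = presented_class_simps(1-7)[of A_rels, folded A_alg_def]

lemma A_hom_eq: "A_hom n = A_class ` homogeneous n"
  by (simp add: A_hom_def homogeneous_def)

lemma A_hom_mult: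
  "a \<in> A_hom m \<Longrightarrow> b \<in> A_hom n \<Longrightarrow> a \<otimes>\<^bsub>A_alg\<^esub> b \<in> A_hom (m + n)"
  by (auto simp: A_hom_eq A_simps intro: homogeneous_mult)

lemma A_hom_add:
  "a \<in> A_hom n \<Longrightarrow> b \<in> A_hom n \<Longrightarrow> a \<oplus>\<^bsub>A_alg\<^esub> b \<in> A_hom n"
  by (auto simp: A_hom_eq A_simps intro: homogeneous_add)

lemma A_hom_smult: "a \<in> A_hom n \<Longrightarrow> c \<odot>\<^bsub>A_alg\<^esub> a \<in> A_hom n"
  by (auto simp: A_hom_eq A_simps intro: homogeneous_smult)

lemma A_hom_zero: "\<zero>\<^bsub>A_alg\<^esub> \<in> A_hom n"
  by (auto simp: A_hom_eq A_simps intro: homogeneous_zero)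

lemma A_hom_carrier: "a \<in> A_hom n \<Longrightarrow> a \<in> carrier A_alg"
  by (auto simp: A_hom_eq A_simps)

lemma A_class_hom: "f \<in> homogeneous n \<Longrightarrow> A_class f \<in> A_hom n"
  by (simp add: A_hom_eq)

interpretation A0: calg A0_alg
  unfolding A0_alg_def
proof (rule A.subalg_calg)
  show "a \<otimes>\<^bsub>A_alg\<^esub> b \<in> A_hom 0" if "a \<in> A_hom 0" "b \<in> A_hom 0" for a b
    using A_hom_mult[OF that] by simp
  show "\<one>\<^bsub>A_alg\<^esub> \<in> A_hom 0"
    by (simp add: A_simps A_class_hom homogeneous_one)
qed (auto intro: A_hom_add A_hom_smult A_hom_carrier)

lemma A0_simps:
  "carrier A0_alg = A_hom 0" "mult A0_alg = mult A_alg" "add A0_alg = add A_alg"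
  "one A0_alg = one A_alg" "zero A0_alg = zero A_alg" "smult A0_alg = smult A_alg"
  by (simp_all add: A0_alg_def)

section \<open>The ideal \<open>I0\<close> and its cosets\<close>

definition I0_gens :: "Agen free set set" where
  "I0_gens = (\<Union>n\<in>{1..}. {a \<otimes>\<^bsub>A_alg\<^esub> b | a b. a \<in> A_hom n \<and> b \<in> A_hom (- n)})"

lemma I0_gensI: "1 \<le> n \<Longrightarrow> a \<in> A_hom n \<Longrightarrow> b \<in> A_hom (- n) \<Longrightarrow> a \<otimes>\<^bsub>A_alg\<^esub> b \<in> I0_gens"
  by (auto simp: I0_gens_def)

lemma I0_gensE:
  assumes "x \<in> I0_gens"
  obtains n a b where "1 \<le> n" "a \<in> A_hom n" "b \<in> A_hom (- n)" "x = a \<otimes>\<^bsub>A_alg\<^esub> b"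
  using assms by (auto simp: I0_gens_def)

lemma I0_eq: "I0 = lin_span A_alg I0_gens"
  by (simp add: I0_def I0_gens_def)

lemma I0_subset: "I0 \<subseteq> A_hom 0"
proof
  fix x assume "x \<in> I0"
  thus "x \<in> A_hom 0"
    unfolding I0_eq
  proof induction
    case (incl x)
    thus ?case using A_hom_mult by (elim I0_gensE) fastforce
  qed (simp_all add: A_hom_zero A_hom_add A_hom_smult)
qed

text \<open>A factor of degree 0 is absorbed by the neighbouring factor of a generator without
  changing its degree.\<close>

lemma I0_mult:
  assumes "x \<in> I0" "y \<in> A_hom 0"
  shows "y \<otimes>\<^bsub>A_alg\<^esub> x \<in> I0" "x \<otimes>\<^bsub>A_alg\<^esub> y \<in> I0"
proof -
  have y: "y \<in> carrier A_alg" using assms A_hom_carrier by blast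
  have "y \<otimes>\<^bsub>A_alg\<^esub> x \<in> I0 \<and> x \<otimes>\<^bsub>A_alg\<^esub> y \<in> I0"
    using assms(1) unfolding I0_eq
  proof induction
    case zero
    thus ?case using y by (simp add: lin_span.zero)
  next
    case (incl x)
    then obtain n a b where ab: "1 \<le> n" "a \<in> A_hom n" "b \<in> A_hom (- n)" "x = a \<otimes>\<^bsub>A_alg\<^esub> b"
      by (rule I0_gensE)
    have "y \<otimes>\<^bsub>A_alg\<^esub> a \<in> A_hom n" "b \<otimes>\<^bsub>A_alg\<^esub> y \<in> A_hom (- n)"
      using A_hom_mult[OF assms(2) ab(2)] A_hom_mult[OF ab(3) assms(2)] by simp_all
    hence "(y \<otimes>\<^bsub>A_alg\<^esub> a) \<otimes>\<^bsub>A_alg\<^esub> b \<in> I0_gens" "a \<otimes>\<^bsub>A_alg\<^esub> (b \<otimes>\<^bsub>A_alg\<^esub> y) \<in> I0_gens"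
      using I0_gensI ab by blast+
    thus ?case
      using y ab(2,3)[THEN A_hom_carrier] by (simp add: ab(4) A.m_assoc lin_span.incl)
  next
    case (add u v)
    hence "u \<in> carrier A_alg" "v \<in> carrier A_alg"
      using I0_subset A_hom_carrier unfolding I0_eq by blast+
    thus ?case using y add by (simp add: A.l_distr A.r_distr lin_span.add)
  next
    case (smult u c)
    hence "u \<in> carrier A_alg"
      using I0_subset A_hom_carrier unfolding I0_eq by blast
    thus ?case using y smult by (simp add: A.smult_mult_left A.smult_mult_right lin_span.smult)
  qed
  thus "y \<otimes>\<^bsub>A_alg\<^esub> x \<in> I0" "x \<otimes>\<^bsub>A_alg\<^esub> y \<in> I0" by auto
qed

lemma I0_ideal: "ideal I0 A0_alg"
proof (rule idealI[OF A0.ring_axioms])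
  show "subgroup I0 (add_monoid A0_alg)"
  proof (rule A0.add.subgroupI)
    show "\<ominus>\<^bsub>A0_alg\<^esub> x \<in> I0" if "x \<in> I0" for x
      using that I0_subset A0.smult_minus_one[of x] lin_span.smult[of x A_alg I0_gens "-1"]
      by (auto simp: A0_simps I0_eq)
  qed (use I0_subset in \<open>auto simp: A0_simps I0_eq intro: lin_span.intros\<close>)
qed (auto simp: A0_simps I0_mult)

lemmas A0bar_simps = A0.quot_simps[OF I0_ideal, folded A0bar_def]

lemma A0bar_class_simps:
  shows "carrier A0bar = A0bar_class ` homogeneous 0"
    and "f \<in> homogeneous 0 \<Longrightarrow> g \<in> homogeneous 0 \<Longrightarrow>
      A0bar_class f \<oplus>\<^bsub>A0bar\<^esub> A0bar_class g = A0bar_class (f + g)"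
    and "f \<in> homogeneous 0 \<Longrightarrow> g \<in> homogeneous 0 \<Longrightarrow>
      A0bar_class f \<otimes>\<^bsub>A0bar\<^esub> A0bar_class g = A0bar_class (f * g)"
    and "\<one>\<^bsub>A0bar\<^esub> = A0bar_class 1"
    and "f \<in> homogeneous 0 \<Longrightarrow> c \<odot>\<^bsub>A0bar\<^esub> A0bar_class f = A0bar_class (Poly_Mapping.single 0 c * f)"
proof -
  have A0: "A_class f \<in> carrier A0_alg" if "f \<in> homogeneous 0" for f
    using that by (simp add: A0_simps A_class_hom)
  show "carrier A0bar = A0bar_class ` homogeneous 0"
    by (auto simp: A0bar_simps A0bar_class_def A0_simps A_hom_eq)
  show "\<one>\<^bsub>A0bar\<^esub> = A0bar_class 1"
    by (simp add: A0bar_simps A0bar_class_def A0_simps A_simps)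
  show "A0bar_class f \<oplus>\<^bsub>A0bar\<^esub> A0bar_class g = A0bar_class (f + g)"
    "A0bar_class f \<otimes>\<^bsub>A0bar\<^esub> A0bar_class g = A0bar_class (f * g)"
    if "f \<in> homogeneous 0" "g \<in> homogeneous 0"
    using that[THEN A0] by (simp_all add: A0bar_simps A0bar_class_def) (simp_all add: A0_simps A_simps)
  show "c \<odot>\<^bsub>A0bar\<^esub> A0bar_class f = A0bar_class (Poly_Mapping.single 0 c * f)"
    if "f \<in> homogeneous 0"
    using that[THEN A0] by (simp add: A0bar_simps A0bar_class_def) (simp add: A0_simps A_simps)
qed

text \<open>The pullback of \<open>I0\<close> to the free algebra, which lets the two successive
  quotients be handled as one.\<close>

definition A0bar_kernel :: "Agen free set" where
  "A0bar_kernel = {f \<in> homogeneous 0. A_class f \<in> I0}"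

lemma A0bar_class_eq_iff:
  assumes "f \<in> homogeneous 0" "g \<in> homogeneous 0"
  shows "A0bar_class f = A0bar_class g \<longleftrightarrow> f - g \<in> A0bar_kernel"
proof -
  have carrier: "A_class h \<in> carrier A0_alg" if "h \<in> homogeneous 0" for h
    using that by (simp add: A0_simps A_hom_eq)
  have diff: "f - g \<in> homogeneous 0" using assms by (rule homogeneous_diff)
  \<comment> \<open>Negation in \<open>A0_alg\<close> refers to its own carrier, so it is reached by
    additive cancellation.\<close>
  have "A_class f \<ominus>\<^bsub>A0_alg\<^esub> A_class g =
      (A_class (f - g) \<oplus>\<^bsub>A0_alg\<^esub> A_class g) \<ominus>\<^bsub>A0_alg\<^esub> A_class g"
    by (simp add: A0_simps A_simps)
  also have "\<dots> = A_class (f - g)"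
    using carrier[OF diff] carrier[OF assms(2)] by (simp add: a_minus_def A0.a_assoc A0.r_neg)
  finally show ?thesis
    using A0.coset_eq_iff[OF I0_ideal carrier carrier, OF assms] diff
    by (simp add: A0bar_class_def A0bar_kernel_def)
qed

lemma A0bar_kernel_closed:
  shows "0 \<in> A0bar_kernel"
    and "f \<in> A0bar_kernel \<Longrightarrow> g \<in> A0bar_kernel \<Longrightarrow> f + g \<in> A0bar_kernel"
    and "f \<in> A0bar_kernel \<Longrightarrow> g \<in> homogeneous 0 \<Longrightarrow> f * g \<in> A0bar_kernel"
    and "f \<in> A0bar_kernel \<Longrightarrow> g \<in> homogeneous 0 \<Longrightarrow> g * f \<in> A0bar_kernel"
    and "f \<in> A0bar_kernel \<Longrightarrow> Poly_Mapping.single 0 c * f \<in> A0bar_kernel"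
proof -
  show "0 \<in> A0bar_kernel"
    using lin_span.zero[of A_alg I0_gens]
    by (simp add: A0bar_kernel_def homogeneous_zero I0_eq A_simps)
  show "f + g \<in> A0bar_kernel" if "f \<in> A0bar_kernel" "g \<in> A0bar_kernel"
    using that lin_span.add[of "A_class f" A_alg I0_gens "A_class g"]
    by (simp add: A0bar_kernel_def homogeneous_add I0_eq A_simps)
  show "f * g \<in> A0bar_kernel" "g * f \<in> A0bar_kernel"
    if "f \<in> A0bar_kernel" "g \<in> homogeneous 0"
    using that I0_mult[of "A_class f" "A_class g"] homogeneous_mult[of f 0 g 0] homogeneous_mult[of g 0 f 0]
    by (auto simp: A0bar_kernel_def A_simps A_hom_eq)
  show "Poly_Mapping.single 0 c * f \<in> A0bar_kernel" if "f \<in> A0bar_kernel"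
    using that lin_span.smult[of "A_class f" A_alg I0_gens c]
    by (simp add: A0bar_kernel_def homogeneous_smult I0_eq A_simps)
qed

lemma A0bar_kernel_rel:
  assumes "f \<in> Idl\<^bsub>free_calg\<^esub> A_rels" "f \<in> homogeneous 0"
  shows "f \<in> A0bar_kernel"
proof -
  have "A_class f = \<zero>\<^bsub>A_alg\<^esub>" using assms by (simp add: A_simps)
  thus ?thesis using assms by (simp add: A0bar_kernel_def I0_eq lin_span.zero)
qed

lemma A0bar_kernel_negative:
  assumes "f \<in> homogeneous n" "g \<in> homogeneous (- n)" "1 \<le> n"
  shows "f * g \<in> A0bar_kernel"
proof -
  have "A_class f \<otimes>\<^bsub>A_alg\<^esub> A_class g \<in> I0_gens"
    using assms by (intro I0_gensI[of n]) (auto simp: A_hom_eq)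
  moreover have "f * g \<in> homogeneous 0" using homogeneous_mult[OF assms(1,2)] by simp
  ultimately show ?thesis by (simp add: A0bar_kernel_def A_simps I0_eq lin_span.incl)
qed

text \<open>The coefficient lives on representatives and \<open>I0\<close> on classes. Each element
  of \<open>I0\<close> gets one representative with coefficient 0, and invariance under relators
  extends this to all.\<close>

lemma vac_coeff_kernel:
  assumes "f \<in> A0bar_kernel"
  shows "vac_coeff f = 0"
proof -
  have well_defined: "vac_coeff f = vac_coeff g" if "A_class f = A_class g" for f g
    using that vac_coeff_A_rels[of "f - g"] by (simp add: A_simps vac_coeff_linear)
  have "\<exists>f. A_class f = x \<and> vac_coeff f = 0" if "x \<in> I0" for x
    using that unfolding I0_eq
  proof induction
    case zero
    show ?case by (intro exI[of _ 0]) (simp add: A_simps vac_coeff_linear)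
  next
    case (incl x)
    then obtain n a b where ab: "1 \<le> n" "a \<in> A_hom n" "b \<in> A_hom (- n)" "x = a \<otimes>\<^bsub>A_alg\<^esub> b"
      by (rule I0_gensE)
    then obtain f g where "a = A_class f" "b = A_class g" "g \<in> homogeneous (- n)"
      by (auto simp: A_hom_eq)
    thus ?case using ab
      by (intro exI[of _ "f * g"]) (auto simp: A_simps intro: vac_coeff_mult_negative)
  next
    case (add x y)
    then obtain f g where "A_class f = x" "vac_coeff f = 0" "A_class g = y" "vac_coeff g = 0" by blast
    thus ?case by (intro exI[of _ "f + g"]) (auto simp: A_simps vac_coeff_linear)
  next
    case (smult x c)
    then obtain f where "A_class f = x" "vac_coeff f = 0" by blast
    thus ?case
      by (intro exI[of _ "Poly_Mapping.single 0 c * f"]) (auto simp: A_simps vac_coeff_linear)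
  qed
  then obtain g where "A_class g = A_class f" "vac_coeff g = 0"
    using assms by (auto simp: A0bar_kernel_def)
  thus ?thesis using well_defined[of g f] by simp
qed

abbreviation A_section :: "laurent \<Rightarrow> Agen free" where
  "A_section \<equiv> laurent_section (Y 0) (Ystar 0)"

lemma A_section_homogeneous: "A_section p \<in> homogeneous 0"
proof (induction p rule: poly_mapping_linear_induct)
  case (single k c)
  have "letters_deg (power_word (Y 0) (Ystar 0) k) = 0"
    by (simp add: power_word_def sum_list_replicate)
  thus ?case
    by (simp add: laurent_single[of k c] laurent_section_linear laurent_section_t_pow
        homogeneous_smult homogeneous_word)
qed (simp_all add: laurent_section_linear homogeneous_zero homogeneous_add)

lemma vac_coeff_power_words:
  assumes "set xs \<subseteq> {Y 0, Ystar 0}"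
  shows "vac_coeff (word xs) = t_pow (sum_list (map gen_charge xs))"
  using assms by (intro vac_coeff_word) auto

text \<open>A concatenation of two powers still has only letters of degree 0, so its coefficient
  depends on the total charge alone and no cancellation is required.\<close>

lemma vac_coeff_section_mult: "vac_coeff (A_section p * A_section q) = p * q"
proof (induction p rule: poly_mapping_linear_induct)
  case (single k c)
  show ?case
  proof (induction q rule: poly_mapping_linear_induct)
    case (single l d)
    let ?w = "power_word (Y 0) (Ystar 0)"
    have "A_section (Poly_Mapping.single k c) * A_section (Poly_Mapping.single l d) =
        Poly_Mapping.single 0 (c * d) * word (?w k @ ?w l)"
      by (simp add: laurent_section_def lin_ext_mult word_append mult_single)
        (metis (no_types, lifting) mult.assoc mult_single single_zero_commute add_0)
    also have "vac_coeff \<dots> = Poly_Mapping.single 0 (c * d) * t_pow (k + l)"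
      using power_word_set[of "Y 0" "Ystar 0"]
      by (subst vac_coeff_linear, subst vac_coeff_power_words) (auto simp: sum_list_power_word)
    finally show ?case by (simp add: mult_single)
  qed (simp_all add: laurent_section_linear vac_coeff_linear distrib_left)
qed (simp_all add: laurent_section_linear vac_coeff_linear distrib_right)

lemma vac_coeff_section: "vac_coeff (A_section p) = p"
proof -
  have "A_section 1 = 1"
    using laurent_section_t_pow[of "Y 0" "Ystar 0" 0] by (simp add: power_word_def word_Nil)
  thus ?thesis using vac_coeff_section_mult[of p 1] by simp
qed

lemma power_word_diff_kernel:
  assumes "set xs \<subseteq> {Y 0, Ystar 0}"
  shows "word xs - word (power_word (Y 0) (Ystar 0) (sum_list (map gen_charge xs))) \<in> A0bar_kernel"
proof (rule word_diff_power_word_mem[OF _ _ A0bar_kernel_closed(1,2) _ _ _ _ assms])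
  fix x :: Agen and f n assume x: "x \<in> {Y 0, Ystar 0}" and f: "f \<in> A0bar_kernel"
  show "gen x * f \<in> A0bar_kernel"
    using x f homogeneous_gen[of x] by (intro A0bar_kernel_closed) auto
  show "f * word (replicate n x) \<in> A0bar_kernel"
    using x f by (intro A0bar_kernel_closed homogeneous_word) (auto simp: sum_list_replicate)
next
  have rel: "gen (Y m) * gen (Ystar (- m)) + gen (Ystar (- m - 1)) * gen (Y (m + 1)) - 1
      \<in> A0bar_kernel" for m
  proof (rule A0bar_kernel_rel)
    have "gen (Y m) * gen (Ystar (- m)) + gen (Ystar (- m - 1)) * gen (Y (m + 1)) -
        (if m + - m = 0 then 1 else 0) \<in> A_rels"
      unfolding A_rels_def by blast
    thus "gen (Y m) * gen (Ystar (- m)) + gen (Ystar (- m - 1)) * gen (Y (m + 1)) - 1 \<in>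
        Idl\<^bsub>free_calg\<^esub> A_rels"
      by (simp add: A_rels_Idl(2))
    have "gen (Y m) * gen (Ystar (- m)) \<in> homogeneous 0" for m
      using homogeneous_mult[OF homogeneous_gen homogeneous_gen, of "Y m" "Ystar (- m)"] by simp
    moreover have "gen (Ystar (- m - 1)) * gen (Y (m + 1)) \<in> homogeneous 0"
      using homogeneous_mult[OF homogeneous_gen homogeneous_gen, of "Ystar (- m - 1)" "Y (m + 1)"] by simp
    ultimately show "gen (Y m) * gen (Ystar (- m)) + gen (Ystar (- m - 1)) * gen (Y (m + 1)) - 1
        \<in> homogeneous 0"
      by (intro homogeneous_diff homogeneous_add homogeneous_one)
  qed
  have diff: "a \<in> A0bar_kernel" if "a + b \<in> A0bar_kernel" "b \<in> A0bar_kernel" for a b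
    using A0bar_kernel_closed(2)[OF that(1) A0bar_kernel_closed(5)[OF that(2), of "-1"]]
    by (simp add: single_uminus)
  \<comment> \<open>The relation with \<open>m = 0\<close> equates
    \<open>gen (Y 0) * gen (Ystar 0) - 1\<close> with minus this product of degrees 1 and -1;
    \<open>m = - 1\<close> treats the opposite order.\<close>
  have "gen (Ystar (- 1)) * gen (Y 1) \<in> A0bar_kernel"
    using A0bar_kernel_negative[of "gen (Ystar (- 1))" 1 "gen (Y 1)"]
      homogeneous_gen[of "Ystar (- 1)"] homogeneous_gen[of "Y 1"] by simp
  thus "gen (Y 0) * gen (Ystar 0) - 1 \<in> A0bar_kernel"
    using rel[of 0] by (intro diff[of "gen (Y 0) * gen (Ystar 0) - 1"]) (simp_all add: diff_add_eq)
  have "gen (Y (- 1)) * gen (Ystar 1) \<in> A0bar_kernel"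
    using A0bar_kernel_negative[of "gen (Y (- 1))" 1 "gen (Ystar 1)"]
      homogeneous_gen[of "Y (- 1)"] homogeneous_gen[of "Ystar 1"] by simp
  thus "gen (Ystar 0) * gen (Y 0) - 1 \<in> A0bar_kernel"
    using rel[of "- 1"]
    by (intro diff[of "gen (Ystar 0) * gen (Y 0) - 1"]) (simp_all add: add_diff_eq add.commute)
qed simp_all

lemma letters_deg_zero: "\<forall>y\<in>set ys. gen_deg y = 0 \<Longrightarrow> letters_deg ys = 0"
  by (induction ys) auto

lemma normal_deg_nonneg: "normal xs \<Longrightarrow> 0 \<le> letters_deg xs"
  by (induction xs) (auto simp: letters_deg_zero)

text \<open>After a positive first letter the normal tail, of nonnegative degree, could not bring
  the total back to 0.\<close>

lemma normal_degree_0: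
  assumes "normal xs" "letters_deg xs = 0"
  shows "set xs \<subseteq> {Y 0, Ystar 0}"
proof
  fix x assume x: "x \<in> set xs"
  have "gen_deg x = 0"
  proof (cases xs)
    case (Cons y ys)
    have "\<not> (gen_deg y > 0 \<and> normal ys)"
      using assms(2) normal_deg_nonneg[of ys] by (auto simp: Cons)
    thus ?thesis using assms(1) x by (auto simp: Cons)
  qed (use x in simp)
  thus "x \<in> {Y 0, Ystar 0}" by (cases x) auto
qed

lemma diff_section_kernel:
  assumes "f \<in> homogeneous 0"
  shows "f - A_section (vac_coeff f) \<in> A0bar_kernel"
proof -
  define P where "P f \<longleftrightarrow> f - A_section (vac_coeff f) \<in> A0bar_kernel" for f
  have P_add: "P (f + g)" if "P f" "P g" for f g
    using A0bar_kernel_closed(2)[OF that[unfolded P_def]]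
    by (simp add: P_def vac_coeff_linear laurent_section_linear algebra_simps)
  have P_smult: "P (Poly_Mapping.single 0 c * f)" if "P f" for c f
    using A0bar_kernel_closed(5)[OF that[unfolded P_def], of c]
    by (simp add: P_def vac_coeff_linear laurent_section_linear right_diff_distrib)
  have P_kernel: "P f" if "f \<in> A0bar_kernel" for f
    using that vac_coeff_kernel[OF that] by (simp add: P_def laurent_section_linear)
  have P_span: "P f" if "f \<in> normal_span 0 L" for f L
    using that
  proof induction
    case (rel r)
    thus ?case by (intro P_kernel A0bar_kernel_rel)
  next
    case (negative ys xs)
    \<comment> \<open>Total degree 0 forces \<open>xs\<close> to have degree at least 1: in degree 0
      the left ideal becomes \<open>I0\<close>.\<close>
    hence "word xs * word ys \<in> A0bar_kernel"
      by (intro A0bar_kernel_negative[of _ "letters_deg xs"] homogeneous_word) auto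
    thus ?case by (simp add: word_append P_kernel)
  next
    case (normal xs)
    hence xs: "set xs \<subseteq> {Y 0, Ystar 0}" by (intro normal_degree_0)
    show ?case
      using power_word_diff_kernel[OF xs]
      by (simp add: P_def vac_coeff_power_words[OF xs] laurent_section_t_pow)
  qed (simp_all add: P_add P_smult)
  \<comment> \<open>Expanding over the support keeps every word in degree 0.\<close>
  have "P (\<Sum>w\<in>S. Poly_Mapping.single w (c w))"
    if "\<And>w. w \<in> S \<Longrightarrow> word_deg w = 0" "finite S" for S c
    using that(2,1)
  proof induction
    case empty
    show ?case using P_kernel A0bar_kernel_closed(1) by simp
  next
    case (insert w S)
    have "word (letters w) \<in> normal_span 0 (length (letters w))"
      using word_normal_span[of "letters w"] insert.prems[of w] by (simp add: word_deg_def)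
    hence "P (Poly_Mapping.single w (c w))"
      unfolding single_eq_smult_word[of w] by (rule P_smult[OF P_span])
    thus ?case using insert by (simp add: P_add)
  qed
  moreover have "f = (\<Sum>w\<in>Poly_Mapping.keys f. Poly_Mapping.single w (Poly_Mapping.lookup f w))"
    by (rule poly_mapping_eqI) (simp add: lookup_sum lookup_single when_def in_keys_iff)
  moreover have "word_deg w = 0" if "w \<in> Poly_Mapping.keys f" for w
    using assms that by (simp add: homogeneous_def)
  ultimately have "P f" by (metis finite_keys)
  thus ?thesis by (simp add: P_def)
qed

lemma A0bar_iso_laurent:
  obtains \<phi> where "\<phi> \<in> calg_iso A0bar group_calg_int"
    "\<And>f. f \<in> homogeneous 0 \<Longrightarrow> \<phi> (A0bar_class f) = vac_coeff f"
proof (rule calg_iso_common_cover)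
  show "A0bar_class ` homogeneous 0 = carrier A0bar"
    by (simp add: A0bar_class_simps)
  show "vac_coeff ` homogeneous 0 = carrier group_calg_int"
  proof -
    have "p \<in> vac_coeff ` homogeneous 0" for p
      using A_section_homogeneous by (rule image_eqI[rotated]) (simp add: vac_coeff_section)
    thus ?thesis by auto
  qed
  show "A0bar_class f = A0bar_class g \<longleftrightarrow> vac_coeff f = vac_coeff g"
    if "f \<in> homogeneous 0" "g \<in> homogeneous 0" for f g
  proof -
    have "f - g \<in> A0bar_kernel \<longleftrightarrow> vac_coeff (f - g) = 0"
      using vac_coeff_kernel[of "f - g"] diff_section_kernel[of "f - g"] homogeneous_diff[OF that]
      by (auto simp: laurent_section_linear)
    thus ?thesis using A0bar_class_eq_iff[OF that] by (simp add: vac_coeff_linear)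
  qed
  show "1 \<in> homogeneous 0" "A0bar_class 1 = \<one>\<^bsub>A0bar\<^esub>" "vac_coeff 1 = \<one>\<^bsub>group_calg_int\<^esub>"
    using vac_coeff_word[of "[]"] by (simp_all add: homogeneous_one A0bar_class_simps word_Nil)
  fix f g assume f: "f \<in> homogeneous 0" and g: "g \<in> homogeneous 0"
  show "\<exists>h\<in>homogeneous 0. A0bar_class h = A0bar_class f \<oplus>\<^bsub>A0bar\<^esub> A0bar_class g \<and>
      vac_coeff h = vac_coeff f \<oplus>\<^bsub>group_calg_int\<^esub> vac_coeff g"
    using f g by (intro bexI[of _ "f + g"]) (simp_all add: A0bar_class_simps vac_coeff_linear homogeneous_add)
  show "\<exists>h\<in>homogeneous 0. A0bar_class h = A0bar_class f \<otimes>\<^bsub>A0bar\<^esub> A0bar_class g \<and>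
      vac_coeff h = vac_coeff f \<otimes>\<^bsub>group_calg_int\<^esub> vac_coeff g"
  proof (intro bexI conjI)
    let ?f = "A_section (vac_coeff f)" and ?g = "A_section (vac_coeff g)"
    \<comment> \<open>This sum is \<open>f * g - ?f * ?g\<close>, so multiplicativity reduces to the
      sections.\<close>
    have "(f - ?f) * g + ?f * (g - ?g) \<in> A0bar_kernel"
      using f g by (intro A0bar_kernel_closed diff_section_kernel A_section_homogeneous)
    hence "vac_coeff (f * g - ?f * ?g) = 0"
      by (intro vac_coeff_kernel) (simp add: algebra_simps)
    thus "vac_coeff (f * g) = vac_coeff f \<otimes>\<^bsub>group_calg_int\<^esub> vac_coeff g"
      by (simp add: vac_coeff_linear vac_coeff_section_mult)
    show "A0bar_class (f * g) = A0bar_class f \<otimes>\<^bsub>A0bar\<^esub> A0bar_class g"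
      using f g by (simp add: A0bar_class_simps)
    show "f * g \<in> homogeneous 0"
      using homogeneous_mult[OF f g] by simp
  qed
  show "\<exists>h\<in>homogeneous 0. A0bar_class h = c \<odot>\<^bsub>A0bar\<^esub> A0bar_class f \<and>
      vac_coeff h = c \<odot>\<^bsub>group_calg_int\<^esub> vac_coeff f" for c
    using f by (intro bexI[of _ "Poly_Mapping.single 0 c * f"])
      (simp_all add: A0bar_class_simps vac_coeff_linear homogeneous_smult)
qed (use that in blast)

subsection \<open>The algebra on two mutually inverse generators\<close>

fun B_charge :: "Bgen \<Rightarrow> int" where
  "B_charge Y0bar = 1"
| "B_charge Y0starbar = -1"

text \<open>Evaluation of the two generators at \<open>t\<close> and its inverse.\<close>

definition B_eval :: "Bgen free \<Rightarrow> laurent" where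
  "B_eval = lin_ext (\<lambda>w. t_pow (sum_list (map B_charge (letters w))))"

lemma B_eval_linear:
  "B_eval 0 = 0"
  "B_eval (f + g) = B_eval f + B_eval g"
  "B_eval (f - g) = B_eval f - B_eval g"
  "B_eval (Poly_Mapping.single 0 c * f) = Poly_Mapping.single 0 c * B_eval f"
  by (simp_all add: B_eval_def lin_ext_add lin_ext_diff lin_ext_smult)

lemma B_eval_mult: "B_eval (f * g) = B_eval f * B_eval g"
  unfolding B_eval_def by (rule lin_ext_mult) (simp add: plus_fmon_def mult_single)

lemma B_eval_word: "B_eval (word xs) = t_pow (sum_list (map B_charge xs))"
  by (simp add: B_eval_def lin_ext_word)

lemma B_eval_one: "B_eval 1 = 1"
  using B_eval_word[of "[]"] by (simp add: word_Nil)

lemma B_eval_B_rels: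
  assumes "f \<in> Idl\<^bsub>free_calg\<^esub> B_rels"
  shows "B_eval f = 0"
proof -
  interpret ring "free_calg :: Bgen free calgebra" by (rule monoid_calg_ring)
  have uminus: "B_eval (- f) = - B_eval f" for f
    using B_eval_linear(2)[of f "- f"] by (simp add: B_eval_linear(1) add_eq_0_iff)
  have "ideal {f. B_eval f = 0} free_calg"
    by (intro idealI monoid_calg_ring add.subgroupI)
      (auto simp: B_eval_mult B_eval_linear(2) uminus intro!: exI[of _ 0] B_eval_linear(1))
  moreover have "B_rels \<subseteq> {f. B_eval f = 0}"
    by (auto simp: B_rels_def B_eval_linear(3) B_eval_mult gen_eq_word B_eval_word B_eval_one mult_single)
  ultimately show ?thesis using genideal_minimal assms by blast
qed

abbreviation B_section :: "laurent \<Rightarrow> Bgen free" where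
  "B_section \<equiv> laurent_section Y0bar Y0starbar"

lemma B_eval_section: "B_eval (B_section p) = p"
proof (induction p rule: poly_mapping_linear_induct)
  case (single k c)
  show ?case
    by (simp add: laurent_single[of k c] laurent_section_linear laurent_section_t_pow
        B_eval_linear B_eval_word sum_list_power_word)
qed (simp_all add: laurent_section_linear B_eval_linear)

text \<open>Every letter is already one of the two generators, so cancellation alone suffices, with
  the relator ideal as \<open>N\<close>.\<close>

lemma diff_B_section: "f - B_section (B_eval f) \<in> Idl\<^bsub>free_calg\<^esub> B_rels"
proof -
  interpret ring "free_calg :: Bgen free calgebra" by (rule monoid_calg_ring)
  note closed = free_ideal_closed[OF presented_class_simps(9)[of B_rels]]
  have rels: "f \<in> Idl\<^bsub>free_calg\<^esub> B_rels" if "f \<in> B_rels" for f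
    using that genideal_self[of B_rels] by auto
  show ?thesis
  proof (induction f rule: poly_mapping_linear_induct)
    case (single w c)
    have "set (letters w) \<subseteq> {Y0bar, Y0starbar}"
      using Bgen.exhaust by auto
    hence "word (letters w) - word (power_word Y0bar Y0starbar (sum_list (map B_charge (letters w))))
        \<in> Idl\<^bsub>free_calg\<^esub> B_rels"
      by (rule word_diff_power_word_mem[OF _ _ closed(1,2) closed(3) closed(4) rels rels, rotated -1])
        (simp_all add: B_rels_def)
    hence "Poly_Mapping.single 0 c * (word (letters w) -
        word (power_word Y0bar Y0starbar (sum_list (map B_charge (letters w))))) \<in> Idl\<^bsub>free_calg\<^esub> B_rels"
      by (rule closed(3))
    thus ?case
      by (simp add: single_eq_smult_word[of w c] B_eval_linear B_eval_word laurent_section_linear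
          laurent_section_t_pow right_diff_distrib)
  next
    case (add f g)
    thus ?case
      using closed(2)[OF add] by (simp add: B_eval_linear laurent_section_linear algebra_simps)
  qed (simp add: B_eval_linear laurent_section_linear closed(1))
qed

lemma B_iso_laurent:
  obtains \<phi> where "\<phi> \<in> calg_iso B_alg group_calg_int"
    "\<And>f. \<phi> (presented_class B_rels f) = B_eval f"
proof (rule calg_iso_common_cover)
  note S = presented_class_simps(1-7)[of B_rels, folded B_alg_def]
  show "range (presented_class B_rels) = carrier B_alg" by (simp add: S)
  show "range B_eval = carrier group_calg_int"
    using B_eval_section by (metis monoid_calg_simps(1) surjI)
  show "presented_class B_rels f = presented_class B_rels g \<longleftrightarrow> B_eval f = B_eval g" for f g
    using B_eval_B_rels[of "f - g"] diff_B_section[of "f - g"]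
    by (auto simp: S B_eval_linear laurent_section_linear)
  show "presented_class B_rels 1 = \<one>\<^bsub>B_alg\<^esub>" "B_eval 1 = \<one>\<^bsub>group_calg_int\<^esub>"
    by (simp_all add: S B_eval_one)
  fix f g
  show "\<exists>h\<in>UNIV. presented_class B_rels h = presented_class B_rels f \<oplus>\<^bsub>B_alg\<^esub> presented_class B_rels g \<and>
      B_eval h = B_eval f \<oplus>\<^bsub>group_calg_int\<^esub> B_eval g"
    by (intro bexI[of _ "f + g"]) (simp_all add: S B_eval_linear)
  show "\<exists>h\<in>UNIV. presented_class B_rels h = presented_class B_rels f \<otimes>\<^bsub>B_alg\<^esub> presented_class B_rels g \<and>
      B_eval h = B_eval f \<otimes>\<^bsub>group_calg_int\<^esub> B_eval g"
    by (intro bexI[of _ "f * g"]) (simp_all add: S B_eval_mult)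
  show "\<exists>h\<in>UNIV. presented_class B_rels h = c \<odot>\<^bsub>B_alg\<^esub> presented_class B_rels f \<and>
      B_eval h = c \<odot>\<^bsub>group_calg_int\<^esub> B_eval f" for c
    by (intro bexI[of _ "Poly_Mapping.single 0 c * f"]) (simp_all add: S B_eval_linear)
qed (use that in blast)+

theorem proposition3p9:
  shows "(\<exists>\<phi> \<in> calg_iso A0bar B_alg.
            \<phi> (A0bar_class (gen (Y 0))) = presented_class B_rels (gen Y0bar) \<and>
            \<phi> (A0bar_class (gen (Ystar 0))) = presented_class B_rels (gen Y0starbar)) \<and>
         calg_iso A0bar group_calg_int \<noteq> {}"
proof -
  obtain \<alpha> where \<alpha>: "\<alpha> \<in> calg_iso A0bar group_calg_int"
    "\<And>f. f \<in> homogeneous 0 \<Longrightarrow> \<alpha> (A0bar_class f) = vac_coeff f"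
    using A0bar_iso_laurent by blast
  obtain \<beta> where \<beta>: "\<beta> \<in> calg_iso B_alg group_calg_int"
    "\<And>f. \<beta> (presented_class B_rels f) = B_eval f"
    using B_iso_laurent by blast
  have calg: "calg B_alg"
    unfolding B_alg_def by (rule presented_class_simps(8))
  define \<phi> where "\<phi> = inv_into (carrier B_alg) \<beta> \<circ> \<alpha>"
  have "\<phi> \<in> calg_iso A0bar B_alg"
    unfolding \<phi>_def using \<alpha>(1) calg_iso_sym[OF calg \<beta>(1)] by (rule calg_iso_trans)
  \<comment> \<open>Classes correspond as soon as their Laurent polynomials agree, which fixes the
    images of the generators.\<close>
  moreover have \<phi>: "\<phi> (A0bar_class f) = presented_class B_rels g"
    if "f \<in> homogeneous 0" "vac_coeff f = B_eval g" for f g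
  proof -
    have "inj_on \<beta> (carrier B_alg)" "presented_class B_rels g \<in> carrier B_alg"
      using \<beta>(1) by (auto simp: calg_iso_def ring_iso_def bij_betw_def presented_class_simps(1) B_alg_def)
    moreover have "\<alpha> (A0bar_class f) = \<beta> (presented_class B_rels g)"
      using that by (simp add: \<alpha>(2) \<beta>(2))
    ultimately show ?thesis by (simp add: \<phi>_def)
  qed
  moreover have "\<phi> (A0bar_class (gen (Y 0))) = presented_class B_rels (gen Y0bar)"
    using vac_coeff_word[of "[Y 0]"] homogeneous_gen[of "Y 0"]
    by (intro \<phi>) (simp_all add: gen_eq_word B_eval_word)
  moreover have "\<phi> (A0bar_class (gen (Ystar 0))) = presented_class B_rels (gen Y0starbar)"
    using vac_coeff_word[of "[Ystar 0]"] homogeneous_gen[of "Ystar 0"]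
    by (intro \<phi>) (simp_all add: gen_eq_word B_eval_word)
  ultimately show ?thesis using \<alpha>(1) by blast
qed

end
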